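(* Let $G=(V,E,w)$ be an $n$-vertex weighted undirected graph with polynomial aspect ratio, and let $k,h\in[n]=\{1,\dots,n\}$. Then there is a distribution $\mathcal{D}$ over clan embeddings $(f,\chi)$ of $G$ into ultrametrics with hop-distortion $\left(O(k),O(k\cdot\log n),h\right)$ and hop-path-distortion $\left(O(k\cdot\log n),h\right)$, such that for every vertex $v\in V$, $\mathbb{E}_{(f,\chi)\sim\mathcal{D}}[|f(v)|]\le O(n^{1/k})$. In addition, for every $\epsilon\in(0,1)$, there is a distribution $\mathcal{D}$ over clan embeddings of $G$ into ultrametrics such that every clan embedding in the support has hop-distortion $\left(O(\frac{\log n}{\epsilon}),O(\frac{\log^2 n}{\epsilon}),h\right)$ and hop-path-distortion $\left(O(\frac{\log^2 n}{\epsilon}),h\right)$, and such that for every vertex $v\in V$, $\mathbb{E}_{(f,\chi)\sim\mathcal{D}}[|f(v)|]\le1+\epsilon$.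
   Context: Graphs are undirected with finite positive edge weights. For $h\in\mathbb{N}$, $d_G^{(h)}(u,v)$ is the minimum weight of a $u$-$v$ path in $G$ with at most $h$ edges (hops), and is $\infty$ if no such path exists. The aspect ratio of $G$ is $\max_{e\in E}w(e)/\min_{e\in E}w(e)$; "polynomial aspect ratio" means it is at most $n^{c}$ for a fixed constant $c$ (constants hidden in $O(\cdot)$ may depend on $c$, and are otherwise universal; logarithmic factors inside $O(\cdot)$ are understood to be at least $1$). An ultrametric is a metric space with $d(x,z)\le\max\{d(x,y),d(y,z)\}$ for all $x,y,z$; the value $\infty$ is allowed as a distance. A one-to-many embedding of $V$ into a metric space $Y$ is a map $f:V\to2^Y$ sending each vertex to a non-empty set (its copies), with the sets $\{f(v)\}_{v\in V}$ pairwise disjoint. It is dominating if $d_G(u,v)\le\min_{u'\in f(u),v'\in f(v)}d_Y(u',v')$ for all $u,v$. A clan embedding is a pair $(f,\chi)$ where $f$ is a dominating one-to-many embedding and $\chi:V\to Y$ satisfies $\chi(v)\in f(v)$ for all $v$ (the chief of $v$). $(f,\chi)$ has hop-distortion $(t,\beta,h)$ if for all $u,v\in V$: $d_G^{(\beta\cdot h)}(u,v)\le\min_{v'\in f(v),u'\in f(u)}d_Y(v',u')$ and $\min_{v'\in f(v)}d_Y(v',\chi(u))\le t\cdot d_G^{(h)}(u,v)$. A subgraph $H$ of $G$ is $h$-respecting if $d_G^{(h)}(u,v)\le d_H(u,v)$ for all $u,v\in V(H)$, where $d_H$ is the shortest path distance in $H$. A (not necessarily simple) path $P=(v_0,\dots,v_m)$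 in $G$ is $h$-respecting if the subgraph of $G$ consisting of the vertices and edges of $P$ is $h$-respecting. $f$ has hop-path-distortion $(t,h)$ if for every $h$-respecting path $P=(v_0,\dots,v_m)$ there are $v_i'\in f(v_i)$ such that $\sum_{i=0}^{m-1}d_Y(v_i',v_{i+1}')\le t\cdot\sum_{i=0}^{m-1}w(v_i,v_{i+1})$. *)

theory Defs
  imports "HOL-Probability.Probability"
begin

record 'a wgraph =
  verts :: "'a set"
  edges :: "'a set set"
  wt :: "'a set \<Rightarrow> real"

definition weighted_graph :: "'a wgraph \<Rightarrow> bool" where
  "weighted_graph G \<longleftrightarrow>
     finite (verts G) \<and>
     (\<forall>e\<in>edges G. e \<subseteq> verts G \<and> card e = 2) \<and>
     (\<forall>e\<in>edges G. 0 < wt G e)"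

definition aspect_ratio :: "'a wgraph \<Rightarrow> real" where
  "aspect_ratio G = Max (wt G ` edges G) / Min (wt G ` edges G)"

text \<open>The aspect ratio is only meaningful if there is an edge; edgeless graphs are admitted.\<close>

definition aspect_ratio_le_pow :: "real \<Rightarrow> 'a wgraph \<Rightarrow> bool" where
  "aspect_ratio_le_pow c G \<longleftrightarrow>
     (edges G \<noteq> {} \<longrightarrow> aspect_ratio G \<le> real (card (verts G)) powr c)"

text \<open>Paths are non-empty vertex lists and may repeat vertices; a list \<open>p\<close> has
  \<open>length p - 1\<close> hops.\<close>

definition is_path :: "'a wgraph \<Rightarrow> 'a list \<Rightarrow> bool" where
  "is_path G p \<longleftrightarrow>
     p \<noteq> [] \<and> set p \<subseteq> verts G \<and>
     (\<forall>i. Suc i < length p \<longrightarrow> {p ! i, p ! Suc i} \<in> edges G)"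

definition path_weight :: "'a wgraph \<Rightarrow> 'a list \<Rightarrow> real" where
  "path_weight G p = (\<Sum>i<length p - 1. wt G {p ! i, p ! Suc i})"

definition paths_between :: "'a wgraph \<Rightarrow> 'a \<Rightarrow> 'a \<Rightarrow> 'a list set" where
  "paths_between G u v = {p. is_path G p \<and> hd p = u \<and> last p = v}"

text \<open>In \<^typ>\<open>ennreal\<close>, the infimum over the empty set is \<open>\<infinity>\<close>; over a non-empty set of paths
  between two vertices of a (finite) weighted graph it is attained.\<close>

definition graph_dist :: "'a wgraph \<Rightarrow> 'a \<Rightarrow> 'a \<Rightarrow> ennreal" where
  "graph_dist G u v = (INF p\<in>paths_between G u v. ennreal (path_weight G p))"

definition hop_dist :: "'a wgraph \<Rightarrow> nat \<Rightarrow> 'a \<Rightarrow> 'a \<Rightarrow> ennreal" where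
  "hop_dist G h u v =
     (INF p\<in>{p \<in> paths_between G u v. length p - 1 \<le> h}. ennreal (path_weight G p))"

definition is_subgraph :: "'a wgraph \<Rightarrow> 'a wgraph \<Rightarrow> bool" where
  "is_subgraph H G \<longleftrightarrow>
     weighted_graph H \<and> verts H \<subseteq> verts G \<and> edges H \<subseteq> edges G \<and>
     (\<forall>e\<in>edges H. wt H e = wt G e)"

definition h_respecting :: "'a wgraph \<Rightarrow> nat \<Rightarrow> 'a wgraph \<Rightarrow> bool" where
  "h_respecting G h H \<longleftrightarrow>
     is_subgraph H G \<and>
     (\<forall>u\<in>verts H. \<forall>v\<in>verts H. hop_dist G h u v \<le> graph_dist H u v)"

definition path_subgraph :: "'a wgraph \<Rightarrow> 'a list \<Rightarrow> 'a wgraph" where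
  "path_subgraph G p =
     \<lparr>verts = set p, edges = {{p ! i, p ! Suc i} | i. Suc i < length p}, wt = wt G\<rparr>"

definition h_respecting_path :: "'a wgraph \<Rightarrow> nat \<Rightarrow> 'a list \<Rightarrow> bool" where
  "h_respecting_path G h p \<longleftrightarrow> is_path G p \<and> h_respecting G h (path_subgraph G p)"

text \<open>Distances are \<^typ>\<open>ennreal\<close>-valued: they are non-negative and may be \<open>\<infinity>\<close>.\<close>

definition ultrametric :: "'p set \<Rightarrow> ('p \<Rightarrow> 'p \<Rightarrow> ennreal) \<Rightarrow> bool" where
  "ultrametric Y d \<longleftrightarrow>
     (\<forall>x\<in>Y. \<forall>y\<in>Y. d x y = 0 \<longleftrightarrow> x = y) \<and>
     (\<forall>x\<in>Y. \<forall>y\<in>Y. d x y = d y x) \<and>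
     (\<forall>x\<in>Y. \<forall>y\<in>Y. \<forall>z\<in>Y. d x z \<le> max (d x y) (d y z))"

record ('a, 'p) embedding =
  points :: "'p set"
  pdist :: "'p \<Rightarrow> 'p \<Rightarrow> ennreal"
  copies :: "'a \<Rightarrow> 'p set"
  chief :: "'a \<Rightarrow> 'p"

definition one_to_many :: "'a wgraph \<Rightarrow> ('a, 'p) embedding \<Rightarrow> bool" where
  "one_to_many G F \<longleftrightarrow>
     (\<forall>v\<in>verts G. copies F v \<noteq> {} \<and> copies F v \<subseteq> points F) \<and>
     disjoint_family_on (copies F) (verts G)"

definition copies_dist :: "('a, 'p) embedding \<Rightarrow> 'a \<Rightarrow> 'a \<Rightarrow> ennreal" where
  "copies_dist F u v = (INF u'\<in>copies F u. INF v'\<in>copies F v. pdist F u' v')"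

definition dominating :: "'a wgraph \<Rightarrow> ('a, 'p) embedding \<Rightarrow> bool" where
  "dominating G F \<longleftrightarrow>
     (\<forall>u\<in>verts G. \<forall>v\<in>verts G. graph_dist G u v \<le> copies_dist F u v)"

definition ultrametric_clan_embedding :: "'a wgraph \<Rightarrow> ('a, 'p) embedding \<Rightarrow> bool" where
  "ultrametric_clan_embedding G F \<longleftrightarrow>
     ultrametric (points F) (pdist F) \<and>
     one_to_many G F \<and> dominating G F \<and>
     (\<forall>v\<in>verts G. chief F v \<in> copies F v)"

text \<open>The factor \<open>\<beta>\<close> is real, and "at most \<open>\<beta> * h\<close> hops" is the same as "at most
  \<open>\<lfloor>\<beta> * h\<rfloor>\<close> hops".\<close>

definition hop_distortion ::
  "'a wgraph \<Rightarrow> ('a, 'p) embedding \<Rightarrow> real \<Rightarrow> real \<Rightarrow> nat \<Rightarrow> bool" where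
  "hop_distortion G F t \<beta> h \<longleftrightarrow>
     (\<forall>u\<in>verts G. \<forall>v\<in>verts G.
        hop_dist G (nat \<lfloor>\<beta> * real h\<rfloor>) u v \<le> copies_dist F v u \<and>
        (INF v'\<in>copies F v. pdist F v' (chief F u)) \<le> ennreal t * hop_dist G h u v)"

definition hop_path_distortion ::
  "'a wgraph \<Rightarrow> ('a, 'p) embedding \<Rightarrow> real \<Rightarrow> nat \<Rightarrow> bool" where
  "hop_path_distortion G F t h \<longleftrightarrow>
     (\<forall>p. h_respecting_path G h p \<longrightarrow>
        (\<exists>q. length q = length p \<and>
             (\<forall>i<length p. q ! i \<in> copies F (p ! i)) \<and>
             (\<Sum>i<length p - 1. pdist F (q ! i) (q ! Suc i))
               \<le> ennreal (t * path_weight G p)))"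

text \<open>Counting measure is used so that infinitely many copies count as \<open>\<infinity>\<close>
  (\<^const>\<open>card\<close> would give \<open>0\<close>).\<close>

definition expected_copies :: "('a, 'p) embedding pmf \<Rightarrow> 'a \<Rightarrow> ennreal" where
  "expected_copies D v =
     (\<integral>\<^sup>+F. emeasure (count_space UNIV) (copies F v) \<partial>measure_pmf D)"

text \<open>Clipped at \<open>1\<close> so that the bounds do not degenerate for \<open>n = 1\<close>.\<close>

definition log_factor :: "nat \<Rightarrow> real" where
  "log_factor n = max 1 (ln (real n))"

end

(* Scales are powers of two between the smallest edge weight and n times the largest one. At
   each scale a cluster A is covered by layered balls: with x maximizing the measure of the inner
   ball, some triple of consecutive layers I <= M <= C around x satisfies
   mu(C) <= (mu(outer ball) / mu(inner ball))^(1/k) mu(I). One recurses on C at the next scale,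
   removes I from A and continues; a vertex has its chief in C iff it lies in M. Layers are
   h hops and one unit of length apart, and the outer ball of a scale is the inner ball of the
   next, so that the growth factors telescope to mu(V)^(1/k) while the hop budget grows by
   O(k h) per scale. An h-respecting path is cut greedily, and at each scale the cuts cost O(k)
   times its weight. The weighted bound sum mu(v) |f(v)| <= mu(V)^(1+1/k) for every mu >= 1
   becomes a distribution by the minimax principle. *)

theory Submission imports Defs begin


section \<open>Consecutive sums along lists\<close>

text \<open>The obstacle is that hop-bounded distance is no metric: its triangle inequality adds the
  hop budgets. Every widening of a ball by a layer therefore costs further hops, and
  \<open>2 * K\<close> layers at each of \<open>T = O(log n)\<close> scales produce the factor
  \<open>k log n\<close> on the hops. The stretch stays \<open>O(k)\<close> because it is only the
  ratio between the label of a scale and the width of one layer. Cluster diameters are measured in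
  \<open>G\<close> and not inside the cluster, so deleting vertices from a cluster never lengthens a
  distance. The second claim needs an expectation arbitrarily close to 1, which a constant factor in
  front of \<open>n powr (1 / K)\<close> would prevent. The minimax step therefore uses weights
  \<open>1 + n * p\<close>, of total \<open>2 * n\<close>. Since every vertex has at least one copy,
  the constant part can be subtracted, leaving \<open>2 * q - 1\<close> with
  \<open>q = (2 * n) powr (1 / K)\<close>, which tends to 1 as \<open>K\<close> grows.\<close>

definition chain_sum :: "('b \<Rightarrow> 'b \<Rightarrow> 'c::comm_monoid_add) \<Rightarrow> 'b list \<Rightarrow> 'c" where
  "chain_sum f xs = (\<Sum>i<length xs - 1. f (xs ! i) (xs ! Suc i))"

lemma chain_sum_simps [simp]:
  "chain_sum f [] = 0"
  "chain_sum f [x] = 0"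
  "chain_sum f (x # y # zs) = f x y + chain_sum f (y # zs)"
  by (simp_all add: chain_sum_def sum.lessThan_Suc_shift del: sum.lessThan_Suc)

lemma chain_sum_append:
  assumes "xs \<noteq> []" "ys \<noteq> []"
  shows "chain_sum f (xs @ ys) = chain_sum f xs + f (last xs) (hd ys) + chain_sum f ys"
  using assms
proof (induction xs rule: induct_list012)
  case (2 x)
  then show ?case by (cases ys) auto
qed (simp_all add: add.assoc)

lemma chain_sum_rev:
  assumes "\<And>x y. f x y = f y x"
  shows "chain_sum f (rev xs) = chain_sum f xs"
proof (induction xs rule: induct_list012)
  case (3 x y zs)
  then show ?case
    using chain_sum_append[of "rev (y # zs)" "[x]" f] by (simp add: assms[of x y] add.commute)
qed simp_all

lemma chain_sum_map: "chain_sum f (map g xs) = chain_sum (\<lambda>x y. f (g x) (g y)) xs"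
  by (induction xs rule: induct_list012) simp_all

lemma chain_sum_nonneg:
  fixes f :: "'b \<Rightarrow> 'b \<Rightarrow> real"
  assumes "\<And>i. Suc i < length xs \<Longrightarrow> 0 \<le> f (xs ! i) (xs ! Suc i)"
  shows "0 \<le> chain_sum f xs"
  unfolding chain_sum_def by (rule sum_nonneg) (auto intro: assms)

lemma path_weight_chain_sum: "path_weight G p = chain_sum (\<lambda>u v. wt G {u, v}) p"
  by (simp add: path_weight_def chain_sum_def)

section \<open>Paths and hop-bounded distances\<close>

lemma is_path_append:
  assumes "xs \<noteq> []" "ys \<noteq> []"
  shows "is_path G (xs @ ys) \<longleftrightarrow> is_path G xs \<and> is_path G ys \<and> {last xs, hd ys} \<in> edges G"
proof
  assume L: "is_path G (xs @ ys)"
  have E: "Suc i < length xs + length ys \<Longrightarrow> {(xs @ ys) ! i, (xs @ ys) ! Suc i} \<in> edges G" for i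
    using L by (auto simp: is_path_def)
  have "{xs ! i, xs ! Suc i} \<in> edges G" if "Suc i < length xs" for i
    using E[of i] that by (simp add: nth_append)
  moreover have "{ys ! i, ys ! Suc i} \<in> edges G" if "Suc i < length ys" for i
    using E[of "length xs + i"] that by (simp add: nth_append)
  moreover have "{last xs, hd ys} \<in> edges G"
    using E[of "length xs - 1"] assms by (simp add: nth_append last_conv_nth hd_conv_nth)
  ultimately show "is_path G xs \<and> is_path G ys \<and> {last xs, hd ys} \<in> edges G"
    using L assms by (auto simp: is_path_def)
next
  assume R: "is_path G xs \<and> is_path G ys \<and> {last xs, hd ys} \<in> edges G"
  have "{(xs @ ys) ! i, (xs @ ys) ! Suc i} \<in> edges G" if i: "Suc i < length (xs @ ys)" for i
  proof -
    consider "Suc i < length xs" | "Suc i = length xs" | "length xs \<le> i"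
      by linarith
    then show ?thesis
    proof cases
      case 2
      then have "xs ! i = last xs"
        using assms by (metis diff_Suc_1 last_conv_nth)
      with 2 show ?thesis using R assms by (simp add: nth_append hd_conv_nth)
    next
      case 3
      then obtain j where "i = length xs + j" using le_Suc_ex by blast
      then show ?thesis using R i by (auto simp: is_path_def nth_append)
    qed (use R i in \<open>auto simp: is_path_def nth_append\<close>)
  qed
  then show "is_path G (xs @ ys)" using R by (auto simp: is_path_def)
qed

lemma is_path_single [simp]: "is_path G [v] \<longleftrightarrow> v \<in> verts G"
  by (simp add: is_path_def)

lemma is_path_rev: "is_path G (rev p) \<longleftrightarrow> is_path G p"
proof (induction p rule: induct_list012)
  case (3 x y zs)
  have "is_path G (rev (x # y # zs)) \<longleftrightarrow>
      is_path G (rev (y # zs)) \<and> x \<in> verts G \<and> {y, x} \<in> edges G"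
    using is_path_append[of "rev (y # zs)" "[x]" G] by simp
  moreover have "is_path G (x # y # zs) \<longleftrightarrow>
      is_path G (y # zs) \<and> x \<in> verts G \<and> {y, x} \<in> edges G"
    using is_path_append[of "[x]" "y # zs" G] by (auto simp: insert_commute)
  ultimately show ?case using 3 by simp
qed simp_all

lemma path_weight_nonneg:
  assumes "weighted_graph G" "is_path G p"
  shows "0 \<le> path_weight G p"
  unfolding path_weight_chain_sum
  by (rule chain_sum_nonneg) (use assms in \<open>auto simp: is_path_def weighted_graph_def less_imp_le\<close>)

lemma hop_dist_sym: "hop_dist G h u v = hop_dist G h v u"
proof -
  have "hop_dist G h v u \<le> hop_dist G h u v" for u v
    unfolding hop_dist_def
  proof (rule INF_greatest)
    fix p assume "p \<in> {p \<in> paths_between G u v. length p - 1 \<le> h}"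
    then have "rev p \<in> {p \<in> paths_between G v u. length p - 1 \<le> h}"
      by (auto simp: paths_between_def is_path_rev hd_rev last_rev)
    moreover have "path_weight G (rev p) = path_weight G p"
      unfolding path_weight_chain_sum by (rule chain_sum_rev) (simp add: insert_commute)
    ultimately show "(INF p\<in>{p \<in> paths_between G v u. length p - 1 \<le> h}. ennreal (path_weight G p))
        \<le> ennreal (path_weight G p)"
      by (metis (no_types, lifting) INF_lower)
  qed
  from this[of u v] this[of v u] show ?thesis by (rule antisym)
qed

lemma hop_dist_antimono: "a \<le> b \<Longrightarrow> hop_dist G b u v \<le> hop_dist G a u v"
  unfolding hop_dist_def by (rule INF_superset_mono) auto

lemma graph_dist_le_hop_dist: "graph_dist G u v \<le> hop_dist G h u v"
  unfolding hop_dist_def graph_dist_def by (rule INF_superset_mono) auto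

lemma hop_dist_refl:
  assumes "v \<in> verts G" shows "hop_dist G h v v = 0"
proof -
  have "[v] \<in> {p \<in> paths_between G v v. length p - 1 \<le> h}"
    using assms by (simp add: paths_between_def)
  then have "hop_dist G h v v \<le> ennreal (path_weight G [v])"
    unfolding hop_dist_def by (rule INF_lower)
  then show ?thesis by (simp add: path_weight_chain_sum)
qed

text \<open>Concatenate the two walks, keeping the shared vertex \<open>v\<close> once. For a fixed
  budget \<open>hop_dist G h\<close> need not satisfy the triangle inequality.\<close>

lemma hop_dist_triangle:
  assumes "weighted_graph G"
  shows "hop_dist G (a + b) u w \<le> hop_dist G a u v + hop_dist G b v w"
proof -
  let ?P = "{p \<in> paths_between G u v. length p - 1 \<le> a}"
  let ?Q = "{p \<in> paths_between G v w. length p - 1 \<le> b}"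
  have *: "hop_dist G (a + b) u w \<le> ennreal (path_weight G p) + ennreal (path_weight G q)"
    if p: "p \<in> ?P" and q: "q \<in> ?Q" for p q
  proof -
    have ne: "p \<noteq> []" "q \<noteq> []" and paths: "is_path G p" "is_path G q"
      and ends: "hd p = u" "last p = v" "hd q = v" "last q = w"
      using p q by (auto simp: paths_between_def is_path_def)
    obtain zs where q_eq: "q = v # zs" using ne ends by (cases q) auto
    have "p @ zs \<in> {p \<in> paths_between G u w. length p - 1 \<le> a + b} \<and>
        path_weight G (p @ zs) = path_weight G p + path_weight G q"
    proof (cases "zs = []")
      case True
      then show ?thesis using p q_eq ends by (auto simp: paths_between_def path_weight_chain_sum)
    next
      case False
      have "is_path G zs" "{v, hd zs} \<in> edges G"
        using paths(2) is_path_append[of "[v]" zs G] False q_eq by auto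
      then have "is_path G (p @ zs)" using is_path_append[of p zs G] ne False paths ends by auto
      moreover have "hd (p @ zs) = u" "last (p @ zs) = w" using ne False ends q_eq by auto
      moreover have "length (p @ zs) - 1 \<le> a + b"
        using p q q_eq ne(1) by auto
      moreover have "path_weight G (p @ zs) = path_weight G p + path_weight G q"
        unfolding path_weight_chain_sum
        using chain_sum_append[of p zs "\<lambda>u v. wt G {u, v}"]
          chain_sum_append[of "[v]" zs "\<lambda>u v. wt G {u, v}"] ne False ends q_eq
        by (simp add: add.assoc)
      ultimately show ?thesis by (simp add: paths_between_def)
    qed
    then have "hop_dist G (a + b) u w \<le> ennreal (path_weight G p + path_weight G q)"
      unfolding hop_dist_def by (metis (no_types, lifting) INF_lower)
    then show ?thesis
      using path_weight_nonneg[OF assms] paths by simp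
  qed
  have "hop_dist G (a + b) u w \<le> ennreal (path_weight G p) + hop_dist G b v w" if "p \<in> ?P" for p
  proof -
    have "hop_dist G (a + b) u w - ennreal (path_weight G p) \<le> hop_dist G b v w"
      unfolding hop_dist_def[of G b]
    proof (rule INF_greatest)
      fix q assume "q \<in> ?Q"
      from *[OF that this] show "hop_dist G (a + b) u w - ennreal (path_weight G p) \<le> ennreal (path_weight G q)"
        by (simp add: ennreal_minus_le_iff)
    qed
    then show ?thesis by (simp add: ennreal_minus_le_iff)
  qed
  \<comment> \<open>Subtracting the fixed summand moves the infimum outside. The summand has to be
    finite, since \<open>\<top> - \<top> = \<top>\<close> in \<open>ennreal\<close>.\<close>
  then have **: "hop_dist G (a + b) u w - hop_dist G b v w \<le> hop_dist G a u v"
    if "hop_dist G b v w \<noteq> \<top>"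
    unfolding hop_dist_def[of G a]
    using that by (intro INF_greatest) (simp add: ennreal_minus_le_iff add.commute)
  show ?thesis
  proof (cases "hop_dist G b v w = \<top>")
    case False
    with ** show ?thesis by (simp add: ennreal_minus_le_iff add.commute)
  qed simp
qed

lemma hop_dist_ge_edge:
  assumes "u \<noteq> v" and wt: "\<And>e. e \<in> edges G \<Longrightarrow> r \<le> wt G e" and "weighted_graph G"
  shows "ennreal r \<le> hop_dist G h u v"
  unfolding hop_dist_def
proof (rule INF_greatest)
  fix p assume "p \<in> {p \<in> paths_between G u v. length p - 1 \<le> h}"
  then have p: "is_path G p" "hd p = u" "last p = v" by (auto simp: paths_between_def)
  then obtain y zs where peq: "p = u # y # zs"
    using assms(1) by (cases p rule: remdups_adj.cases) (auto simp: is_path_def)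
  then have "{u, y} \<in> edges G" "is_path G (y # zs)"
    using p is_path_append[of "[u]" "y # zs" G] by auto
  then have "r \<le> path_weight G p"
    using wt[of "{u, y}"] path_weight_nonneg[OF assms(3), of "y # zs"]
    unfolding peq path_weight_chain_sum by simp
  then show "ennreal r \<le> ennreal (path_weight G p)" by (rule ennreal_leI)
qed

text \<open>A finite infimum has a witness path, and its at most \<open>h\<close> edges weigh at
  most \<open>W\<close> each. This caps the finite distances and thus the number of scales.\<close>

lemma hop_dist_le_finite:
  assumes "hop_dist G h u v < \<infinity>" and wt: "\<And>e. e \<in> edges G \<Longrightarrow> wt G e \<le> W" and "0 \<le> W"
  shows "hop_dist G h u v \<le> ennreal (real h * W)"
proof -
  obtain p where p: "p \<in> {p \<in> paths_between G u v. length p - 1 \<le> h}"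
    using assms(1) unfolding hop_dist_def by (auto simp: Inf_less_iff)
  have "path_weight G p \<le> (\<Sum>i<length p - 1. W)"
    unfolding path_weight_def using p wt
    by (intro sum_mono) (auto simp: paths_between_def is_path_def)
  also have "\<dots> \<le> real h * W" using p assms(3) by (auto intro: mult_right_mono)
  finally have "ennreal (path_weight G p) \<le> ennreal (real h * W)" by (rule ennreal_leI)
  moreover have "hop_dist G h u v \<le> ennreal (path_weight G p)"
    unfolding hop_dist_def using p by (rule INF_lower)
  ultimately show ?thesis by (rule order.trans[rotated])
qed

text \<open>What the argument uses of an \<open>h\<close>-respecting path; unlike the original notion, this one
  is visibly inherited by subpaths.\<close>

definition segment_respecting :: "'a wgraph \<Rightarrow> nat \<Rightarrow> 'a list \<Rightarrow> bool" where
  "segment_respecting G h p \<longleftrightarrow>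
     (\<forall>xs s ys. p = xs @ s @ ys \<longrightarrow> s \<noteq> [] \<longrightarrow>
        is_path G s \<and> hop_dist G h (hd s) (last s) \<le> ennreal (path_weight G s))"

lemma segment_respecting_sub:
  assumes "segment_respecting G h (xs @ s @ ys)"
  shows "segment_respecting G h s"
  unfolding segment_respecting_def
proof (intro allI impI)
  fix as s' bs assume "s = as @ s' @ bs" "s' \<noteq> []"
  then have "xs @ s @ ys = (xs @ as) @ s' @ (bs @ ys)" by simp
  then show "is_path G s' \<and> hop_dist G h (hd s') (last s') \<le> ennreal (path_weight G s')"
    using assms \<open>s' \<noteq> []\<close> unfolding segment_respecting_def by blast
qed

lemma segment_respectingD:
  assumes "segment_respecting G h (s @ ys)" "s \<noteq> []"
  shows "is_path G s" "hop_dist G h (hd s) (last s) \<le> ennreal (path_weight G s)"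
  using assms unfolding segment_respecting_def by (metis append_Nil)+

text \<open>A segment is itself a walk in the subgraph formed by the whole path, so its weight
  bounds \<open>graph_dist\<close> there, which the hypothesis compares with
  \<open>hop_dist\<close>.\<close>

lemma h_respecting_path_imp_segment_respecting:
  assumes "h_respecting_path G h p"
  shows "segment_respecting G h p"
  unfolding segment_respecting_def
proof (intro allI impI)
  fix xs s ys assume p: "p = xs @ s @ ys" and s: "s \<noteq> []"
  let ?H = "path_subgraph G p"
  have G: "is_path G p" and resp: "\<And>u v. u \<in> set p \<Longrightarrow> v \<in> set p \<Longrightarrow> hop_dist G h u v \<le> graph_dist ?H u v"
    using assms by (auto simp: h_respecting_path_def h_respecting_def path_subgraph_def)
  have nth: "s ! i = p ! (length xs + i)" if "i < length s" for i
    using that p by (simp add: nth_append)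
  have "\<exists>j. {s ! i, s ! Suc i} = {p ! j, p ! Suc j} \<and> Suc j < length p" if "Suc i < length s" for i
    by (rule exI[of _ "length xs + i"]) (use that nth[of i] nth[of "Suc i"] p in auto)
  then have H: "is_path ?H s"
    using s p by (auto simp: is_path_def path_subgraph_def)
  have "\<And>e. e \<in> edges ?H \<Longrightarrow> e \<in> edges G" using G by (auto simp: path_subgraph_def is_path_def)
  then have sG: "is_path G s"
    using H p G unfolding is_path_def by (auto simp: subset_iff)
  have "s \<in> paths_between ?H (hd s) (last s)" using H by (simp add: paths_between_def)
  then have "graph_dist ?H (hd s) (last s) \<le> ennreal (path_weight ?H s)"
    unfolding graph_dist_def by (rule INF_lower)
  moreover have "path_weight ?H s = path_weight G s"
    by (simp add: path_weight_def path_subgraph_def)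
  ultimately show "is_path G s \<and> hop_dist G h (hd s) (last s) \<le> ennreal (path_weight G s)"
    using resp[of "hd s" "last s"] p s sG by (auto intro: order.trans)
qed


section \<open>A minimax principle\<close>

lemma exp_le_quadratic:
  fixes x :: real assumes "0 \<le> x" "x \<le> 1"
  shows "exp x \<le> 1 + x + x\<^sup>2"
  using exp_bound[of x] assms by simp

text \<open>Multiplicative weights: against each mixture of coordinates the adversary answers with a
  vector \<open>a \<in> S\<close>, and the uniform average of the answers is nearly optimal in every
  coordinate at once.\<close>

lemma approximate_minimax:
  fixes S :: "('v \<Rightarrow> real) set"
  assumes V: "finite V" "V \<noteq> {}" and \<delta>: "0 < \<delta>" and "0 \<le> b"
    and bounded: "\<And>a v. a \<in> S \<Longrightarrow> v \<in> V \<Longrightarrow> 0 \<le> a v \<and> a v \<le> M"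
    and response: "\<And>p. (\<And>v. v \<in> V \<Longrightarrow> 0 \<le> p v) \<Longrightarrow> sum p V = 1 \<Longrightarrow>
        \<exists>a\<in>S. (\<Sum>v\<in>V. p v * a v) \<le> b"
  shows "\<exists>N>0. \<exists>a :: nat \<Rightarrow> 'v \<Rightarrow> real.
    (\<forall>i. a i \<in> S) \<and> (\<forall>v\<in>V. (\<Sum>i<N. a i v) \<le> real N * (b + \<delta>))"
proof -
  define M' where "M' = max 1 M"
  have M': "1 \<le> M'" "\<And>a v. a \<in> S \<Longrightarrow> v \<in> V \<Longrightarrow> a v \<le> M'"
    using bounded unfolding M'_def by force+
  \<comment> \<open>The first bound keeps every exponent in the range of
    \<open>exp_le_quadratic\<close>; the second lets the quadratic error use up only half of
    \<delta>.\<close>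
  define \<eta> where "\<eta> = min (1 / M') (\<delta> / (2 * M'\<^sup>2))"
  have \<eta>: "0 < \<eta>" "\<eta> * M' \<le> 1" "\<eta> * M'\<^sup>2 \<le> \<delta> / 2"
    using M' \<delta> by (auto simp: \<eta>_def min_def field_simps)
  let ?W = "\<lambda>l v. exp (\<eta> * (\<Sum>a\<leftarrow>l. a v))"
  have step: "\<exists>a\<in>S. (\<Sum>v\<in>V. ?W l v * a v) \<le> b * sum (?W l) V" for l
  proof -
    have pos: "0 < sum (?W l) V" using V by (intro sum_pos) auto
    then have "\<exists>a\<in>S. (\<Sum>v\<in>V. ?W l v / sum (?W l) V * a v) \<le> b"
      by (intro response) (auto simp: sum_divide_distrib[symmetric] less_imp_le)
    then show ?thesis
      using pos by (simp add: sum_divide_distrib[symmetric] pos_divide_le_eq)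
  qed
  have "\<exists>g. \<forall>l. g l \<in> S \<and> (\<Sum>v\<in>V. ?W l v * g l v) \<le> b * sum (?W l) V"
    by (rule choice) (use step in blast)
  then obtain g where g: "\<And>l. g l \<in> S" "\<And>l. (\<Sum>v\<in>V. ?W l v * g l v) \<le> b * sum (?W l) V"
    by blast
  \<comment> \<open>\<open>g\<close> answers the weights produced by a list of earlier answers, so
    \<open>L n\<close> is the history after \<open>n\<close> rounds, latest answer first.\<close>
  define L where "L n = ((\<lambda>l. g l # l) ^^ n) []" for n
  have L_Suc: "L (Suc n) = g (L n) # L n" for n by (simp add: L_def)
  have L_sum: "(\<Sum>a\<leftarrow>L n. a v) = (\<Sum>i<n. g (L i) v)" for n v
    by (induction n) (simp_all add: L_Suc, simp add: L_def)
  \<comment> \<open>By the choice of \<open>g\<close>, the linear term of each round is at most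
    \<open>\<eta> * b\<close> times the current total weight.\<close>
  have potential: "sum (?W (L n)) V \<le> card V * exp (real n * (\<eta> * b + (\<eta> * M')\<^sup>2))" for n
  proof (induction n)
    case (Suc n)
    have "?W (L (Suc n)) v \<le> ?W (L n) v + \<eta> * (?W (L n) v * g (L n) v) + (\<eta> * M')\<^sup>2 * ?W (L n) v"
      if v: "v \<in> V" for v
    proof -
      let ?x = "\<eta> * g (L n) v"
      have x: "0 \<le> ?x" "?x \<le> \<eta> * M'"
        using bounded[OF g(1) v] M'(2)[OF g(1) v] \<eta> by (auto intro: mult_left_mono)
      have "exp ?x \<le> 1 + ?x + ?x\<^sup>2" using x(1) order.trans[OF x(2) \<eta>(2)] by (rule exp_le_quadratic)
      also have "\<dots> \<le> 1 + ?x + (\<eta> * M')\<^sup>2" using x by (simp add: power_mono)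
      finally have "?W (L n) v * exp ?x \<le> ?W (L n) v * (1 + ?x + (\<eta> * M')\<^sup>2)" by simp
      then show ?thesis
        by (simp add: L_Suc distrib_left exp_add algebra_simps)
    qed
    then have "sum (?W (L (Suc n))) V \<le>
        (\<Sum>v\<in>V. ?W (L n) v + \<eta> * (?W (L n) v * g (L n) v) + (\<eta> * M')\<^sup>2 * ?W (L n) v)"
      by (rule sum_mono)
    also have "\<dots> = sum (?W (L n)) V + \<eta> * (\<Sum>v\<in>V. ?W (L n) v * g (L n) v)
        + (\<eta> * M')\<^sup>2 * sum (?W (L n)) V"
      by (simp only: sum.distrib sum_distrib_left)
    also have "\<dots> \<le> sum (?W (L n)) V + \<eta> * (b * sum (?W (L n)) V) + (\<eta> * M')\<^sup>2 * sum (?W (L n)) V"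
      using g(2)[of "L n"] \<eta>(1) by simp
    also have "\<dots> = (1 + (\<eta> * b + (\<eta> * M')\<^sup>2)) * sum (?W (L n)) V" by (simp add: algebra_simps)
    also have "\<dots> \<le> exp (\<eta> * b + (\<eta> * M')\<^sup>2) * sum (?W (L n)) V"
      by (intro mult_right_mono exp_ge_add_one_self sum_nonneg) auto
    also have "\<dots> \<le> exp (\<eta> * b + (\<eta> * M')\<^sup>2) * (card V * exp (real n * (\<eta> * b + (\<eta> * M')\<^sup>2)))"
      using Suc by (intro mult_left_mono) auto
    also have "\<dots> = card V * exp (real (Suc n) * (\<eta> * b + (\<eta> * M')\<^sup>2))"
      by (simp add: exp_add[symmetric] algebra_simps)
    finally show ?case .
  qed (simp add: L_def)
  \<comment> \<open>Enough rounds for the initial \<open>ln (card V)\<close> to be absorbed by the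
    other half of \<delta>.\<close>
  define N where "N = Suc (nat \<lceil>2 * ln (card V) / (\<eta> * \<delta>)\<rceil>)"
  have cV: "0 < real (card V)" using V by (simp add: card_gt_0_iff)
  have "2 * ln (card V) / (\<eta> * \<delta>) \<le> real N" unfolding N_def by linarith
  then have N: "ln (card V) \<le> real N * (\<eta> * \<delta> / 2)"
    using \<eta> \<delta> by (simp add: pos_divide_le_eq mult_ac)
  have "(\<Sum>i<N. g (L i) v) \<le> real N * (b + \<delta>)" if v: "v \<in> V" for v
  proof -
    have "?W (L N) v \<le> sum (?W (L N)) V" using V v by (intro member_le_sum) auto
    also note potential[of N]
    also have "card V * exp (real N * (\<eta> * b + (\<eta> * M')\<^sup>2)) =
        exp (ln (card V) + real N * (\<eta> * b + (\<eta> * M')\<^sup>2))"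
      using cV by (simp add: exp_add)
    finally have "\<eta> * (\<Sum>i<N. g (L i) v) \<le> ln (card V) + real N * (\<eta> * b + (\<eta> * M')\<^sup>2)"
      by (simp add: L_sum)
    also have "(\<eta> * M')\<^sup>2 \<le> \<eta> * (\<delta> / 2)"
      using mult_left_mono[OF \<eta>(3), of \<eta>] \<eta>(1) by (simp add: power2_eq_square mult_ac)
    finally have "\<eta> * (\<Sum>i<N. g (L i) v) \<le> ln (card V) + real N * (\<eta> * b + \<eta> * (\<delta> / 2))"
      by (simp add: mult_left_mono)
    also have "\<dots> \<le> real N * (\<eta> * \<delta> / 2) + real N * (\<eta> * b + \<eta> * (\<delta> / 2))" using N by simp
    also have "\<dots> = \<eta> * (real N * (b + \<delta>))" by (simp add: algebra_simps)
    finally show ?thesis using \<eta>(1) by simp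
  qed
  moreover have "0 < N" by (simp add: N_def)
  ultimately show ?thesis using g(1) by (intro exI[of _ N] conjI exI[of _ "\<lambda>i. g (L i)"]) auto
qed

text \<open>If all \<open>K\<close> ratios \<open>f (Suc j) / f j\<close> exceeded the bound, their
  product \<open>f K / f 0\<close> would exceed \<open>m / f 0\<close>. The exponent
  \<open>1 / K\<close> in the number of copies originates here.\<close>

lemma exists_small_growth_step:
  fixes f :: "nat \<Rightarrow> real"
  assumes pos: "\<And>j. 0 < f j" and "0 < K" and m: "f K \<le> m"
  shows "\<exists>j<K. f (Suc j) \<le> (m / f 0) powr (1 / real K) * f j"
proof (rule ccontr)
  define q where "q = (m / f 0) powr (1 / real K)"
  assume "\<not> ?thesis"
  then have growth: "q * f j < f (Suc j)" if "j < K" for j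
    using that by (auto simp: not_le q_def)
  have m_pos: "0 < m" using pos[of K] m by linarith
  have "q ^ Suc j * f 0 < f (Suc j)" if "j < K" for j
    using that
  proof (induction j)
    case (Suc j)
    then have "q * (q ^ Suc j * f 0) \<le> q * f (Suc j)"
      by (intro mult_left_mono) (auto simp: q_def)
    also have "\<dots> < f (Suc (Suc j))" by (rule growth) (use Suc in auto)
    finally show ?case by simp
  qed (use growth in auto)
  from this[of "K - 1"] have "q ^ K * f 0 < f K" using \<open>0 < K\<close> by simp
  moreover have "q ^ K = m / f 0"
    using pos[of 0] m_pos \<open>0 < K\<close>
    by (simp add: q_def powr_realpow[symmetric] powr_powr)
  ultimately show False using pos[of 0] m by simp
qed


section \<open>Partial clan embeddings and their gluing\<close>

text \<open>\<open>h\<close> is the budget in the upper estimates and \<open>H\<close>, meant to be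
  larger, the one in the lower estimates. Positivity of \<open>t\<close> makes
  \<open>t * \<infinity>\<close> infinite, so the stretch bound is trivial for pairs at infinite
  distance.\<close>

locale hop_clan =
  fixes G :: "'a wgraph" and h H :: nat and t :: real
  assumes weighted: "weighted_graph G" and t_pos: "0 < t"
begin

text \<open>The label bounds the diameter, so that two such embeddings can be put at mutual distance
  \<open>lab\<close> without breaking the ultrametric inequality. Points are natural numbers to keep
  one type through all gluings; finiteness of the copies makes \<open>card\<close>
  meaningful.\<close>

definition clan_on :: "'a set \<Rightarrow> ennreal \<Rightarrow> ('a, nat) embedding \<Rightarrow> bool" where
  "clan_on A lab F \<longleftrightarrow>
     ultrametric (points F) (pdist F) \<and>
     (\<forall>x\<in>points F. \<forall>y\<in>points F. pdist F x y \<le> lab) \<and>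
     (\<forall>v\<in>A. finite (copies F v) \<and> copies F v \<subseteq> points F \<and> chief F v \<in> copies F v) \<and>
     disjoint_family_on (copies F) A \<and>
     (\<forall>u\<in>A. \<forall>v\<in>A. \<forall>x\<in>copies F u. \<forall>y\<in>copies F v. hop_dist G H u v \<le> pdist F x y) \<and>
     (\<forall>u\<in>A. \<forall>v\<in>A. \<exists>y\<in>copies F v. pdist F y (chief F u) \<le> ennreal t * hop_dist G h u v)"

text \<open>Only paths within \<rho> of their first vertex are considered, because that vertex can
  then decide on which side of a cut the whole path is lifted. With \<open>\<rho> = \<top>\<close>
  the restriction disappears.\<close>

definition lifts :: "'a set \<Rightarrow> ennreal \<Rightarrow> real \<Rightarrow> ('a, nat) embedding \<Rightarrow> bool" where
  "lifts A \<rho> a F \<longleftrightarrow>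
     (\<forall>p. segment_respecting G h p \<longrightarrow> p \<noteq> [] \<longrightarrow> set p \<subseteq> A \<longrightarrow>
        (\<forall>v\<in>set p. hop_dist G h (hd p) v \<le> \<rho>) \<longrightarrow>
        (\<exists>q. list_all2 (\<lambda>y v. y \<in> copies F v) q p \<and>
             chain_sum (pdist F) q \<le> ennreal (a * path_weight G p)))"

text \<open>Separating two vertices at distance \<open>lab\<close> is affordable for these pairs; at
  infinite distance it always is.\<close>

definition far_enough :: "'a set \<Rightarrow> ennreal \<Rightarrow> ennreal \<Rightarrow> bool" where
  "far_enough A \<rho> lab \<longleftrightarrow>
     (\<forall>u\<in>A. \<forall>v\<in>A. \<rho> < hop_dist G h u v \<longrightarrow> hop_dist G h u v < \<infinity> \<longrightarrow>
        lab \<le> ennreal t * hop_dist G h u v)"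

lemma list_all2_copies_in_points:
  assumes "clan_on A lab F" "list_all2 (\<lambda>y v. y \<in> copies F v) q p" "set p \<subseteq> A"
  shows "set q \<subseteq> points F"
  using assms(2,3,1) by (induction rule: list_all2_induct) (auto simp: clan_on_def)

text \<open>A path is cut greedily whenever it moves farther than \<open>\<rho>\<close> from the last cut; each
  cut costs \<open>lab\<close>, which is paid for by the length travelled since the previous one.\<close>

lemma lifts_long:
  assumes F: "clan_on A lab F" and short: "lifts A \<rho> a F" and a: "0 \<le> a"
    and far: "far_enough A \<rho> lab"
  shows "lifts A \<top> (a + t) F"
  unfolding lifts_def
proof (intro allI impI)
  fix p assume "segment_respecting G h p" "p \<noteq> []" "set p \<subseteq> A"
    "\<forall>v\<in>set p. hop_dist G h (hd p) v \<le> \<top>"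
  then show "\<exists>q. list_all2 (\<lambda>y v. y \<in> copies F v) q p \<and>
      chain_sum (pdist F) q \<le> ennreal ((a + t) * path_weight G p)"
  proof (induction p rule: length_induct)
    case (1 p)
    define P where "P v \<longleftrightarrow> hop_dist G h (hd p) v \<le> \<rho>" for v
    define p1 where "p1 = takeWhile P p"
    define p2 where "p2 = dropWhile P p"
    have p: "p = p1 @ p2" by (simp add: p1_def p2_def)
    have p_path: "is_path G p"
      using segment_respectingD(1)[of G h p "[]"] 1 by simp
    then have "hd p \<in> verts G" using 1(3) by (auto simp: is_path_def)
    then have "P (hd p)" by (simp add: P_def hop_dist_refl)
    then have p1_ne: "p1 \<noteq> []" and hd_p1: "hd p1 = hd p"
      using 1(3) by (cases p; simp add: p1_def)+
    have "segment_respecting G h p1" "set p1 \<subseteq> A"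
      using segment_respecting_sub[of G h "[]" p1 p2] 1 p by auto
    moreover have "\<forall>v\<in>set p1. hop_dist G h (hd p1) v \<le> \<rho>"
      unfolding hd_p1 unfolding p1_def using P_def by (auto dest: set_takeWhileD)
    ultimately obtain q1 where q1: "list_all2 (\<lambda>y v. y \<in> copies F v) q1 p1"
      "chain_sum (pdist F) q1 \<le> ennreal (a * path_weight G p1)"
      using short p1_ne unfolding lifts_def by blast
    show ?case
    proof (cases "p2 = []")
      case True
      have "a * path_weight G p \<le> (a + t) * path_weight G p"
        using path_weight_nonneg[OF weighted p_path] t_pos by (intro mult_right_mono) auto
      then show ?thesis using q1 True p by (auto intro!: exI[of _ q1] intro: order.trans ennreal_leI)
    next
      case False
      have p1_path: "is_path G p1" and p2_path: "is_path G p2" and e: "{last p1, hd p2} \<in> edges G"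
        using p_path p is_path_append[OF p1_ne False] by auto
      have "segment_respecting G h p2" "set p2 \<subseteq> A" "length p2 < length p"
        using segment_respecting_sub[of G h p1 p2 "[]"] 1 p p1_ne by auto
      then obtain q2 where q2: "list_all2 (\<lambda>y v. y \<in> copies F v) q2 p2"
        "chain_sum (pdist F) q2 \<le> ennreal ((a + t) * path_weight G p2)"
        using 1(1) False by auto
      define w where "w = path_weight G p1 + wt G {last p1, hd p2}"
      have nonneg: "0 \<le> path_weight G p1" "0 \<le> path_weight G p2" "0 < wt G {last p1, hd p2}"
        using path_weight_nonneg[OF weighted] p1_path p2_path e weighted
        by (auto simp: weighted_graph_def)
      have p_weight: "path_weight G p = w + path_weight G p2"
        unfolding p w_def path_weight_chain_sum using p1_ne False by (simp add: chain_sum_append)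
      \<comment> \<open>The segment charged for the cut ends at the first vertex beyond \<rho>, so
        its weight \<open>w\<close> includes the cut edge. Different cuts charge disjoint stretches
        of the path.\<close>
      have "p = (p1 @ [hd p2]) @ tl p2" using p False by simp
      then have "hop_dist G h (hd (p1 @ [hd p2])) (last (p1 @ [hd p2]))
          \<le> ennreal (path_weight G (p1 @ [hd p2]))"
        using segment_respectingD(2)[of G h "p1 @ [hd p2]" "tl p2"] 1 by auto
      moreover have "path_weight G (p1 @ [hd p2]) = w"
        unfolding w_def path_weight_chain_sum using p1_ne by (simp add: chain_sum_append)
      ultimately have d_le: "hop_dist G h (hd p) (hd p2) \<le> ennreal w"
        using p1_ne hd_p1 by simp
      have "\<not> P (hd p2)" using False unfolding p2_def by (rule hd_dropWhile)
      moreover have "hd p \<in> A" "hd p2 \<in> A"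
        using hd_in_set[OF 1(3)] 1(4) hd_in_set[OF False] \<open>set p2 \<subseteq> A\<close> by blast+
      ultimately have "lab \<le> ennreal t * hop_dist G h (hd p) (hd p2)"
        using far d_le unfolding far_enough_def P_def
        by (simp add: not_le) (meson ennreal_less_top order_le_less_trans)
      also have "\<dots> \<le> ennreal t * ennreal w" using d_le by (rule mult_left_mono) simp
      also have "\<dots> = ennreal (t * w)" using t_pos by (simp add: ennreal_mult')
      finally have lab: "lab \<le> ennreal (t * w)" .
      have q_ne: "q1 \<noteq> []" "q2 \<noteq> []" using q1 q2 p1_ne False by auto
      have "set q1 \<subseteq> points F" "set q2 \<subseteq> points F"
        using list_all2_copies_in_points[OF F] q1(1) q2(1) 1 p by auto
      then have "last q1 \<in> points F" "hd q2 \<in> points F" using q_ne by auto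
      then have cut: "pdist F (last q1) (hd q2) \<le> lab" using F by (auto simp: clan_on_def)
      have "chain_sum (pdist F) (q1 @ q2) =
          chain_sum (pdist F) q1 + pdist F (last q1) (hd q2) + chain_sum (pdist F) q2"
        using q_ne by (rule chain_sum_append)
      also have "\<dots> \<le> ennreal (a * path_weight G p1) + ennreal (t * w) + ennreal ((a + t) * path_weight G p2)"
        using q1 q2 order.trans[OF cut lab] by (intro add_mono) auto
      also have "\<dots> = ennreal (a * path_weight G p1 + t * w + (a + t) * path_weight G p2)"
        using a t_pos nonneg by (simp add: w_def)
      also have "\<dots> \<le> ennreal ((a + t) * path_weight G p)"
        unfolding p_weight using a nonneg
        by (intro ennreal_leI) (simp add: algebra_simps w_def)
      finally show ?thesis
        using q1(1) q2(1) unfolding p by (intro exI[of _ "q1 @ q2"]) (auto intro: list_all2_appendI)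
    qed
  qed
qed

text \<open>The intermediate set \<open>M\<close> decides
  which side a vertex considers its own: within distance \<open>\<rho>\<close> of a vertex of \<open>M\<close> there
  is nothing outside \<open>C\<close>, and within distance \<open>\<rho>\<close> of a vertex outside \<open>M\<close> there is
  nothing in \<open>I\<close>.\<close>

lemma glue:
  assumes F1: "clan_on C lab1 F1" and lab1: "lab1 \<le> lab" and F2: "clan_on (A - I) lab F2"
    and sub: "I \<subseteq> M" "M \<subseteq> C" "C \<subseteq> A"
    and lift1: "lifts C \<top> a F1" and lift2: "lifts (A - I) \<rho> a F2"
    and near_M: "\<And>u v. u \<in> M \<Longrightarrow> v \<in> A \<Longrightarrow> hop_dist G h u v \<le> \<rho> \<Longrightarrow> v \<in> C"
    and near_I: "\<And>u v. u \<in> A \<Longrightarrow> v \<in> I \<Longrightarrow> hop_dist G h u v \<le> \<rho> \<Longrightarrow> u \<in> M"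
    and far: "far_enough A \<rho> lab" and lab_pos: "0 < lab"
    and diam: "\<And>u v. u \<in> A \<Longrightarrow> v \<in> A \<Longrightarrow> hop_dist G H u v \<le> lab"
  shows "\<exists>F. clan_on A lab F \<and> lifts A \<rho> a F \<and>
    (\<forall>v\<in>A. card (copies F v) =
       (if v \<in> C then card (copies F1 v) else 0) + (if v \<in> I then 0 else card (copies F2 v)))"
proof -
  \<comment> \<open>Even and odd numbers form the disjoint union of the two point sets, at mutual
    distance \<open>lab\<close>. A vertex of \<open>C - I\<close> receives copies from both
    sides.\<close>
  define e1 e2 :: "nat \<Rightarrow> nat" where "e1 x = 2 * x" and "e2 x = 2 * x + 1" for x
  have parity: "even (e1 x)" "odd (e2 x)" "e1 x div 2 = x" "e2 x div 2 = x" for x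
    by (auto simp: e1_def e2_def)
  have inj: "inj e1" "inj e2" by (auto simp: inj_def e1_def e2_def)
  have neq: "e1 x \<noteq> e2 y" "e2 y \<noteq> e1 x" "e1 x = e1 x' \<longleftrightarrow> x = x'" "e2 x = e2 x' \<longleftrightarrow> x = x'" for x y x'
    by (auto simp: e1_def e2_def) presburger+
  define F :: "('a, nat) embedding" where
    "F = \<lparr>points = e1 ` points F1 \<union> e2 ` points F2,
          pdist = (\<lambda>x y. if even x \<and> even y then pdist F1 (x div 2) (y div 2)
                         else if odd x \<and> odd y then pdist F2 (x div 2) (y div 2) else lab),
          copies = (\<lambda>v. e1 ` (if v \<in> C then copies F1 v else {}) \<union>
                        e2 ` (if v \<in> A - I then copies F2 v else {})),
          chief = (\<lambda>v. if v \<in> M then e1 (chief F1 v) else e2 (chief F2 v))\<rparr>"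
  have pd: "pdist F (e1 x) (e1 y) = pdist F1 x y" "pdist F (e2 x) (e2 y) = pdist F2 x y"
    "pdist F (e1 x) (e2 y) = lab" "pdist F (e2 x) (e1 y) = lab" for x y
    by (simp_all add: F_def parity)
  have pts: "points F = e1 ` points F1 \<union> e2 ` points F2" by (simp add: F_def)
  have cps: "copies F v = e1 ` (if v \<in> C then copies F1 v else {}) \<union>
                        e2 ` (if v \<in> A - I then copies F2 v else {})" for v by (simp add: F_def)
  have chf: "chief F v = (if v \<in> M then e1 (chief F1 v) else e2 (chief F2 v))" for v
    by (simp add: F_def)
  have le1: "pdist F1 x y \<le> lab" if "x \<in> points F1" "y \<in> points F1" for x y
    using F1 lab1 that unfolding clan_on_def by (meson order.trans)
  have le2: "pdist F2 x y \<le> lab" if "x \<in> points F2" "y \<in> points F2" for x y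
    using F2 that unfolding clan_on_def by blast
  have um1: "ultrametric (points F1) (pdist F1)" and um2: "ultrametric (points F2) (pdist F2)"
    using F1 F2 by (auto simp: clan_on_def)
  have um: "ultrametric (points F) (pdist F)"
    unfolding ultrametric_def
  proof (intro conjI ballI)
    fix x y assume "x \<in> points F" "y \<in> points F"
    then show "pdist F x y = 0 \<longleftrightarrow> x = y" "pdist F x y = pdist F y x"
      using um1 um2 lab_pos unfolding pts ultrametric_def by (auto simp: pd neq)
  next
    fix x y z assume "x \<in> points F" "y \<in> points F" "z \<in> points F"
    \<comment> \<open>If the points lie on both sides, one distance on the right is
      \<open>lab\<close>, the largest value that occurs.\<close>
    then show "pdist F x z \<le> max (pdist F x y) (pdist F y z)"
      using um1 um2 le1 le2 unfolding pts ultrametric_def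
      by (elim UnE imageE) (auto simp: pd le_max_iff_disj)
  qed
  have bd: "\<forall>x\<in>points F. \<forall>y\<in>points F. pdist F x y \<le> lab"
    using le1 le2 unfolding pts by (auto simp: pd)
  have c1: "finite (copies F1 v)" "copies F1 v \<subseteq> points F1" "chief F1 v \<in> copies F1 v" if "v \<in> C" for v
    using F1 that by (auto simp: clan_on_def)
  have c2: "finite (copies F2 v)" "copies F2 v \<subseteq> points F2" "chief F2 v \<in> copies F2 v"
    if "v \<in> A" "v \<notin> I" for v
    using F2 that by (auto simp: clan_on_def)
  have cop: "\<forall>v\<in>A. finite (copies F v) \<and> copies F v \<subseteq> points F \<and> chief F v \<in> copies F v"
  proof (intro ballI conjI)
    fix v assume v: "v \<in> A"
    show "finite (copies F v)" using c1(1) c2(1) v unfolding cps by simp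
    show "copies F v \<subseteq> points F" using c1(2)[of v] c2(2)[of v] v unfolding cps pts by auto
    show "chief F v \<in> copies F v"
    proof (cases "v \<in> M")
      case True
      then show ?thesis using c1(3)[of v] sub by (auto simp: cps chf)
    next
      case False
      then have "v \<notin> I" using sub by auto
      with False show ?thesis using c2(3)[of v] v by (auto simp: cps chf)
    qed
  qed
  have uniq1: "m = n" if "m \<in> C" "n \<in> C" "x \<in> copies F1 m" "x \<in> copies F1 n" for m n x
    using F1 that unfolding clan_on_def disjoint_family_on_def by blast
  have uniq2: "m = n" if "m \<in> A" "m \<notin> I" "n \<in> A" "n \<notin> I" "x \<in> copies F2 m" "x \<in> copies F2 n" for m n x
    using F2 that unfolding clan_on_def disjoint_family_on_def by blast
  have uniq: "m = n" if "m \<in> A" "n \<in> A" "x \<in> copies F m" "x \<in> copies F n" for m n x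
    using that unfolding cps by (auto simp: neq split: if_splits intro: uniq1 uniq2)
  then have disj: "disjoint_family_on (copies F) A"
    unfolding disjoint_family_on_def by blast
  have dom1: "hop_dist G H u v \<le> pdist F1 x y"
    if "u \<in> C" "v \<in> C" "x \<in> copies F1 u" "y \<in> copies F1 v" for u v x y
    using F1 that unfolding clan_on_def by blast
  have dom2: "hop_dist G H u v \<le> pdist F2 x y"
    if "u \<in> A - I" "v \<in> A - I" "x \<in> copies F2 u" "y \<in> copies F2 v" for u v x y
    using F2 that unfolding clan_on_def by blast
  have dom: "\<forall>u\<in>A. \<forall>v\<in>A. \<forall>x\<in>copies F u. \<forall>y\<in>copies F v. hop_dist G H u v \<le> pdist F x y"
  proof (intro ballI)
    fix u v x y assume "u \<in> A" "v \<in> A" "x \<in> copies F u" "y \<in> copies F v"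
    then show "hop_dist G H u v \<le> pdist F x y"
      using dom1 dom2 diam unfolding cps by (auto simp: pd split: if_splits)
  qed
  have chief_close: "\<exists>y\<in>copies F v. pdist F y (chief F u) \<le> ennreal t * hop_dist G h u v"
    if uv: "u \<in> A" "v \<in> A" for u v
  proof (cases "hop_dist G h u v \<le> \<rho>")
    case True
    show ?thesis
    proof (cases "u \<in> M")
      case uM: True
      then have "u \<in> C" "v \<in> C" using near_M True uv sub by auto
      then obtain y where "y \<in> copies F1 v" "pdist F1 y (chief F1 u) \<le> ennreal t * hop_dist G h u v"
        using F1 unfolding clan_on_def by blast
      then show ?thesis using uM \<open>v \<in> C\<close>
        by (intro bexI[of _ "e1 y"]) (auto simp: cps chf pd)
    next
      case uM: False
      then have "u \<in> A - I" "v \<in> A - I" using near_I True uv sub by auto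
      then obtain y where "y \<in> copies F2 v" "pdist F2 y (chief F2 u) \<le> ennreal t * hop_dist G h u v"
        using F2 unfolding clan_on_def by blast
      then show ?thesis using uM \<open>v \<in> A - I\<close>
        by (intro bexI[of _ "e2 y"]) (auto simp: cps chf pd)
    qed
  next
    case False
    \<comment> \<open>Beyond \<rho> the choice of copy does not matter: every distance is at most
      \<open>lab\<close>, which such a pair can pay.\<close>
    have "lab \<le> ennreal t * hop_dist G h u v"
    proof (cases "hop_dist G h u v < \<infinity>")
      case True
      then show ?thesis using far False uv by (auto simp: far_enough_def not_le)
    next
      case False
      then show ?thesis using t_pos by (simp add: top_unique less_top[symmetric] ennreal_mult_top)
    qed
    moreover have "chief F v \<in> copies F v" "pdist F (chief F v) (chief F u) \<le> lab"
      using cop bd uv by blast+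
    ultimately show ?thesis by (meson order.trans)
  qed
  have clan: "clan_on A lab F"
    unfolding clan_on_def using um bd cop disj dom chief_close by blast
  have lift: "lifts A \<rho> a F"
    unfolding lifts_def
  proof (intro allI impI)
    fix p assume p: "segment_respecting G h p" "p \<noteq> []" "set p \<subseteq> A"
      "\<forall>v\<in>set p. hop_dist G h (hd p) v \<le> \<rho>"
    show "\<exists>q. list_all2 (\<lambda>y v. y \<in> copies F v) q p \<and>
        chain_sum (pdist F) q \<le> ennreal (a * path_weight G p)"
    \<comment> \<open>The head fixes the side for the whole path. Inside \<open>C\<close> the path
      may exceed the radius of the finer scale, hence the unrestricted \<open>lift1\<close>.\<close>
    proof (cases "hd p \<in> M")
      case True
      then have "set p \<subseteq> C" using near_M p by blast
      then obtain q where q: "list_all2 (\<lambda>y v. y \<in> copies F1 v) q p"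
        "chain_sum (pdist F1) q \<le> ennreal (a * path_weight G p)"
        using lift1 p unfolding lifts_def by (meson top_greatest)
      have "list_all2 (\<lambda>y v. y \<in> copies F v) (map e1 q) p"
        unfolding list_all2_map1
        by (rule list.rel_mono_strong[OF q(1)]) (use \<open>set p \<subseteq> C\<close> in \<open>auto simp: cps\<close>)
      then show ?thesis using q(2) by (intro exI[of _ "map e1 q"]) (simp add: chain_sum_map pd)
    next
      case False
      have "v \<notin> I" if "v \<in> set p" for v
        using near_I[of "hd p" v] hd_in_set[OF p(2)] that p(3,4) False by blast
      then have sp: "set p \<subseteq> A - I" using p by auto
      then obtain q where q: "list_all2 (\<lambda>y v. y \<in> copies F2 v) q p"
        "chain_sum (pdist F2) q \<le> ennreal (a * path_weight G p)"
        using lift2 p unfolding lifts_def by meson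
      have "list_all2 (\<lambda>y v. y \<in> copies F v) (map e2 q) p"
        unfolding list_all2_map1
        by (rule list.rel_mono_strong[OF q(1)]) (use sp in \<open>auto simp: cps\<close>)
      then show ?thesis using q(2) by (intro exI[of _ "map e2 q"]) (simp add: chain_sum_map pd)
    qed
  qed
  have "card (copies F v) =
       (if v \<in> C then card (copies F1 v) else 0) + (if v \<in> I then 0 else card (copies F2 v))"
    if "v \<in> A" for v
  proof -
    have "card (copies F v) = card (e1 ` (if v \<in> C then copies F1 v else {})) +
        card (e2 ` (if v \<in> A - I then copies F2 v else {}))"
      unfolding cps using that c1 c2 by (intro card_Un_disjoint) (auto simp: neq)
    then show ?thesis
      using that inj by (auto simp: card_image inj_on_subset)
  qed
  with clan lift show ?thesis by blast
qed

text \<open>Base of the recursion: a path at distance 0 from its head never leaves it, so lifting is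
  free.\<close>

lemma singletons:
  assumes fin: "finite A" and lab_pos: "0 < lab"
    and sep: "\<And>u v. u \<noteq> v \<Longrightarrow> 0 < hop_dist G h u v" and far: "far_enough A 0 lab"
    and diam: "\<And>u v. u \<in> A \<Longrightarrow> v \<in> A \<Longrightarrow> hop_dist G H u v \<le> lab" and "A \<subseteq> verts G"
  shows "\<exists>F. clan_on A lab F \<and> lifts A 0 0 F \<and> (\<forall>v\<in>A. card (copies F v) = 1)"
proof -
  obtain f :: "'a \<Rightarrow> nat" where f: "inj_on f A"
    using fin finite_imp_inj_to_nat_seg by blast
  define F :: "('a, nat) embedding" where
    "F = \<lparr>points = f ` A, pdist = (\<lambda>x y. if x = y then 0 else lab),
          copies = (\<lambda>v. {f v}), chief = f\<rparr>"
  have "pdist F (f v) (f u) \<le> ennreal t * hop_dist G h u v" if "u \<in> A" "v \<in> A" for u v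
  proof (cases "u = v \<or> hop_dist G h u v = \<infinity>")
    case True
    then show ?thesis using t_pos by (auto simp: F_def ennreal_mult_top)
  next
    case False
    then show ?thesis using far sep[of u v] that by (auto simp: F_def far_enough_def less_top[symmetric])
  qed
  moreover have "hop_dist G H u v \<le> pdist F (f u) (f v)" if "u \<in> A" "v \<in> A" for u v
    using diam[OF that] hop_dist_refl[of v G] f that \<open>A \<subseteq> verts G\<close> by (auto simp: F_def inj_on_def)
  moreover have "ultrametric (points F) (pdist F)"
    using lab_pos by (auto simp: ultrametric_def F_def)
  moreover have "disjoint_family_on (copies F) A"
    using f by (auto simp: disjoint_family_on_def F_def inj_on_def)
  ultimately have "clan_on A lab F"
    unfolding clan_on_def by (simp add: F_def)
  moreover have "lifts A 0 0 F"
    unfolding lifts_def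
  proof (intro allI impI)
    fix p assume "p \<noteq> []" "\<forall>v\<in>set p. hop_dist G h (hd p) v \<le> 0"
    then have const: "\<And>v. v \<in> set p \<Longrightarrow> v = hd p" using sep by (metis not_less)
    have "chain_sum (pdist F) (map f p) = 0"
      unfolding chain_sum_def
    proof (rule sum.neutral, rule ballI)
      fix i assume "i \<in> {..<length (map f p) - 1}"
      then have "p ! i = hd p" "p ! Suc i = hd p" using const by auto
      then show "pdist F (map f p ! i) (map f p ! Suc i) = 0"
        using \<open>i \<in> _\<close> by (simp add: F_def)
    qed
    then show "\<exists>q. list_all2 (\<lambda>y v. y \<in> copies F v) q p \<and>
        chain_sum (pdist F) q \<le> ennreal (0 * path_weight G p)"
      by (intro exI[of _ "map f p"]) (simp add: list_all2_map1 F_def list.rel_refl)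
  qed
  ultimately show ?thesis by (auto simp: F_def intro!: exI[of _ F])
qed

end


section \<open>The hierarchy of scales\<close>

text \<open>The scales are \<open>r, 2 * r, ..., 2 ^ (T - 1) * r\<close>.\<close>

locale hop_hierarchy =
  fixes G :: "'a wgraph" and h K T :: nat and r :: real and \<mu> :: "'a \<Rightarrow> real"
  assumes weighted_graph: "weighted_graph G"
    and K_pos: "0 < K" and T_pos: "0 < T" and r_pos: "0 < r"
    and separated: "\<And>u v. u \<noteq> v \<Longrightarrow> ennreal r \<le> hop_dist G h u v"
    and bounded: "\<And>u v. hop_dist G h u v < \<infinity> \<Longrightarrow> hop_dist G h u v \<le> ennreal (2 ^ (T - 1) * r)"
    and \<mu>_ge_1: "\<And>v. v \<in> verts G \<Longrightarrow> 1 \<le> \<mu> v"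
begin

text \<open>\<open>4 * T * K * h\<close> is twice the hop budget \<open>2 * K * T * h\<close> of the
  widest balls, for passing through a center. \<open>16 * K\<close> is the quotient of a finite
  \<open>lab (Suc i)\<close> by the layer width \<open>2 ^ i * r\<close>.\<close>

sublocale hop_clan G h "4 * T * K * h" "16 * real K"
  by unfold_locales (use weighted_graph K_pos in auto)

text \<open>Both radius and hop budget are arranged so that the outermost layer \<open>j = 2 * K\<close> at scale
  \<open>i\<close> is the innermost layer at scale \<open>i + 1\<close>; this is what makes the growth factors
  telescope over the scales, at the price of a hop budget linear in \<open>i\<close>.\<close>

definition layer :: "nat \<Rightarrow> nat \<Rightarrow> 'a \<Rightarrow> 'a set" where
  "layer i j x = {y. hop_dist G ((2 * K * i + j) * h) x y
                      \<le> ennreal (r * (2 * real K * (2 ^ i - 1) + real j * 2 ^ i))}"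

text \<open>In units of \<open>r\<close>, \<open>2 * K * (2 ^ i - 1)\<close> is the total width of
  the \<open>2 * K\<close> layers at each scale below \<open>i\<close>; adding those of scale
  \<open>i\<close> gives the same expression for \<open>i + 1\<close>.\<close>

lemma layer_next: "layer i (2 * K) x = layer (Suc i) 0 x"
  by (simp add: layer_def algebra_simps)

lemma layer_center: "x \<in> verts G \<Longrightarrow> x \<in> layer i j x"
  by (simp add: layer_def hop_dist_refl)

lemma layer_mono:
  assumes "j \<le> j'" shows "layer i j x \<subseteq> layer i j' x"
proof
  fix y assume y: "y \<in> layer i j x"
  have "(2 * K * i + j) * h \<le> (2 * K * i + j') * h" using assms by simp
  then have "hop_dist G ((2 * K * i + j') * h) x y \<le> hop_dist G ((2 * K * i + j) * h) x y"
    by (rule hop_dist_antimono)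
  also have "\<dots> \<le> ennreal (r * (2 * real K * (2 ^ i - 1) + real j * 2 ^ i))"
    using y by (simp add: layer_def)
  also have "\<dots> \<le> ennreal (r * (2 * real K * (2 ^ i - 1) + real j' * 2 ^ i))"
    using assms r_pos by (intro ennreal_leI mult_left_mono add_left_mono mult_right_mono) auto
  finally show "y \<in> layer i j' x" by (simp add: layer_def)
qed

lemma layer_step:
  assumes y: "y \<in> layer i j x" and z: "hop_dist G h y z \<le> ennreal (2 ^ i * r)"
  shows "z \<in> layer i (Suc j) x"
proof -
  have nonneg: "0 \<le> 2 * real K * (2 ^ i - 1)" by simp
  have "hop_dist G ((2 * K * i + j) * h + h) x z
      \<le> hop_dist G ((2 * K * i + j) * h) x y + hop_dist G h y z"
    by (rule hop_dist_triangle[OF weighted_graph])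
  also have "\<dots> \<le> ennreal (r * (2 * real K * (2 ^ i - 1) + real j * 2 ^ i)) + ennreal (2 ^ i * r)"
    using y z by (intro add_mono) (auto simp: layer_def)
  also have "\<dots> = ennreal (r * (2 * real K * (2 ^ i - 1) + real j * 2 ^ i) + 2 ^ i * r)"
    using r_pos nonneg by simp
  finally show ?thesis by (simp add: layer_def algebra_simps)
qed

text \<open>Through the center: twice the radius \<open>2 * K * (2 ^ (i + 1) - 1) * r\<close> is
  below \<open>8 * K * 2 ^ i * r\<close>.\<close>

lemma layer_diam:
  assumes "y \<in> layer (Suc i) 0 x" "z \<in> layer (Suc i) 0 x" and "Suc i \<le> T"
  shows "hop_dist G (4 * T * K * h) y z \<le> ennreal (8 * real K * 2 ^ i * r)"
proof -
  let ?s = "2 * K * Suc i * h" and ?R = "r * (2 * real K * (2 ^ Suc i - 1))"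
  have "(1::real) \<le> 2 ^ Suc i" by (rule one_le_power) simp
  then have nonneg: "0 \<le> ?R" using r_pos by (intro mult_nonneg_nonneg) auto
  have "2 * K * h * (2 * Suc i) \<le> 2 * K * h * (2 * T)" using assms(3) by (intro mult_left_mono) auto
  then have "?s + ?s \<le> 4 * T * K * h" by (simp add: algebra_simps)
  then have "hop_dist G (4 * T * K * h) y z \<le> hop_dist G (?s + ?s) y z"
    by (rule hop_dist_antimono)
  also have "\<dots> \<le> hop_dist G ?s y x + hop_dist G ?s x z"
    by (rule hop_dist_triangle[OF weighted_graph])
  also have "\<dots> \<le> ennreal ?R + ennreal ?R"
    using assms(1,2) hop_dist_sym[of G ?s y x] by (intro add_mono) (auto simp: layer_def)
  also have "\<dots> = ennreal (?R + ?R)" using ennreal_plus[OF nonneg nonneg] by (rule sym)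
  also have "\<dots> \<le> ennreal (8 * real K * 2 ^ i * r)"
    using r_pos by (intro ennreal_leI) (simp add: algebra_simps)
  finally show ?thesis .
qed

text \<open>The finite values are the diameters from \<open>layer_diam\<close>. The infinite label
  on top lets the whole vertex set be the first cluster, even if some vertices cannot reach each
  other.\<close>

definition lab :: "nat \<Rightarrow> ennreal" where
  "lab i = (if i < T then ennreal (8 * real K * 2 ^ i * r) else \<top>)"

lemma lab_pos: "0 < lab i"
  using K_pos r_pos by (simp add: lab_def)

lemma lab_mono: "lab i \<le> lab (Suc i)"
  using r_pos by (auto simp: lab_def intro!: ennreal_leI mult_right_mono mult_left_mono power_increasing)

text \<open>At the top the claim is vacuous: no finite distance exceeds
  \<open>2 ^ (T - 1) * r\<close>, so no such pair is charged the infinite label.\<close>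

lemma far_enough_lab:
  assumes "i < T" shows "far_enough A (ennreal (2 ^ i * r)) (lab (Suc i))"
  unfolding far_enough_def
proof (intro ballI impI)
  fix u v assume far: "ennreal (2 ^ i * r) < hop_dist G h u v" and "hop_dist G h u v < \<infinity>"
  then have "hop_dist G h u v \<le> ennreal (2 ^ (T - 1) * r)" by (intro bounded)
  then have "Suc i \<noteq> T" using far by auto
  then have "lab (Suc i) = ennreal (16 * real K) * ennreal (2 ^ i * r)"
    using assms r_pos by (simp add: lab_def ennreal_mult'[symmetric] mult_ac)
  also have "\<dots> \<le> ennreal (16 * real K) * hop_dist G h u v"
    using far by (intro mult_left_mono) auto
  finally show "lab (Suc i) \<le> ennreal (16 * real K) * hop_dist G h u v" .
qed

lemma far_enough_lab_0: "far_enough A 0 (lab 0)"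
  unfolding far_enough_def
proof (intro ballI impI)
  fix u v assume "0 < hop_dist G h u v" "u \<in> A" "v \<in> A" "hop_dist G h u v < \<infinity>"
  show "lab 0 \<le> ennreal (16 * real K) * hop_dist G h u v"
  \<comment> \<open>\<open>A\<close> may contain points that are not vertices; such a point has no
    path to itself and is at infinite distance from itself.\<close>
  proof (cases "u = v \<and> v \<notin> verts G")
    case True
    then have "hop_dist G h u v = \<infinity>"
      by (auto simp: hop_dist_def paths_between_def is_path_def dest: last_in_set)
    with \<open>hop_dist G h u v < \<infinity>\<close> show ?thesis by simp
  next
    case False
    then have "u \<noteq> v" using hop_dist_refl[of v G h] \<open>0 < hop_dist G h u v\<close> by auto
    have "lab 0 \<le> ennreal (16 * real K) * ennreal r"
      using T_pos r_pos by (auto simp: lab_def ennreal_mult'[symmetric] intro!: ennreal_leI)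
    also have "\<dots> \<le> ennreal (16 * real K) * hop_dist G h u v"
      using separated[OF \<open>u \<noteq> v\<close>] by (rule mult_left_mono) simp
    finally show ?thesis .
  qed
qed

section \<open>The recursion within one scale and over the scales\<close>

definition small :: "nat \<Rightarrow> 'a set \<Rightarrow> bool" where
  "small i A \<longleftrightarrow> A \<subseteq> verts G \<and> (\<forall>u\<in>A. \<forall>v\<in>A. hop_dist G (4 * T * K * h) u v \<le> lab i)"

definition mass :: "'a set \<Rightarrow> ('a, nat) embedding \<Rightarrow> real" where
  "mass A F = (\<Sum>v\<in>A. \<mu> v * real (card (copies F v)))"

lemma finite_small: "small i A \<Longrightarrow> finite A"
  using weighted_graph finite_subset by (auto simp: small_def weighted_graph_def)

lemma sum_\<mu>_mono:
  assumes "A \<subseteq> B" "finite B" "B \<subseteq> verts G"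
  shows "sum \<mu> A \<le> sum \<mu> B"
  using assms by (intro sum_mono2) (auto intro: order.trans[OF zero_le_one \<mu>_ge_1])

lemma sum_\<mu>_pos:
  assumes "x \<in> A" "finite A" "A \<subseteq> verts G"
  shows "1 \<le> sum \<mu> A"
  using sum_\<mu>_mono[of "{x}" A] \<mu>_ge_1[of x] assms by auto

lemma exists_embedding_singletons:
  assumes "small i A" "0 = i \<or> A = {}"
  shows "\<exists>F. clan_on A (lab i) F \<and> lifts A 0 0 F \<and> mass A F = sum \<mu> A"
proof -
  have "\<And>u v. u \<noteq> v \<Longrightarrow> 0 < hop_dist G h u v"
    using separated r_pos by (meson ennreal_less_zero_iff order_less_le_trans)
  moreover have "far_enough A 0 (lab i)"
    using assms(2) far_enough_lab_0 by (auto simp: far_enough_def)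
  ultimately have "\<exists>F. clan_on A (lab i) F \<and> lifts A 0 0 F \<and> (\<forall>v\<in>A. card (copies F v) = 1)"
    using assms(1) finite_small[OF assms(1)] lab_pos by (intro singletons) (auto simp: small_def)
  then show ?thesis by (auto simp: mass_def)
qed

text \<open>Induction on \<open>card A\<close>, peeling off \<open>I\<close>. The recursive call on
  \<open>C\<close> costs the factor \<open>f 0 powr (1 / K)\<close>, smaller than
  \<open>m powr (1 / K)\<close> by exactly the growth allowed from \<open>I\<close> to
  \<open>C\<close>. So \<open>C\<close> is charged to \<open>I\<close> alone, although the vertices
  of \<open>C - I\<close> are kept on both sides.\<close>

lemma exists_embedding_step:
  assumes IH: "\<And>C m. small i C \<Longrightarrow> (\<And>y. y \<in> C \<Longrightarrow> sum \<mu> (layer i 0 y \<inter> C) \<le> m) \<Longrightarrow>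
      \<exists>F. clan_on C (lab i) F \<and> lifts C \<top> a F \<and> mass C F \<le> m powr (1 / real K) * sum \<mu> C"
    and i: "i < T" and "0 \<le> a"
    and "small (Suc i) A" and "\<And>y. y \<in> A \<Longrightarrow> sum \<mu> (layer (Suc i) 0 y \<inter> A) \<le> m"
  shows "\<exists>F. clan_on A (lab (Suc i)) F \<and> lifts A (ennreal (2 ^ i * r)) a F \<and>
      mass A F \<le> m powr (1 / real K) * sum \<mu> A"
  using assms(4,5)
proof (induction "card A" arbitrary: A rule: less_induct)
  case less
  note A = less.prems(1)
  note fin = finite_small[OF A]
  have AV: "A \<subseteq> verts G" using A by (simp add: small_def)
  show ?case
  proof (cases "A = {}")
    case True
    then show ?thesis
      using exists_embedding_singletons[OF A] by (auto simp: lifts_def mass_def)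
  next
    case False
    let ?g = "\<lambda>y. sum \<mu> (layer i 0 y \<inter> A)"
    \<comment> \<open>A heaviest inner ball is chosen so that \<open>f 0\<close> bounds the inner
      balls of all points of \<open>C\<close>.\<close>
    obtain x where x: "x \<in> A" and x_max: "\<And>y. y \<in> A \<Longrightarrow> ?g y \<le> ?g x"
    proof -
      have "Max (?g ` A) \<in> ?g ` A" using fin False by (intro Max_in) auto
      then obtain x where "x \<in> A" "Max (?g ` A) = ?g x" by (rule imageE)
      moreover have "?g y \<le> Max (?g ` A)" if "y \<in> A" for y
        using fin that by (intro Max_ge) auto
      ultimately show thesis using that by metis
    qed
    \<comment> \<open>One index step is two layers, leaving room for \<open>M\<close> between
      \<open>I\<close> and \<open>C\<close>; \<open>f K\<close> is the mass of the innermost ball of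
      the next scale.\<close>
    define f where "f j = sum \<mu> (layer i (2 * j) x \<inter> A)" for j
    have f_pos: "0 < f j" for j
      using sum_\<mu>_pos[of x "layer i (2 * j) x \<inter> A"] layer_center[of x] x AV fin
      by (force simp: f_def)
    have "f K \<le> m" using less.prems(2)[OF x] by (simp add: f_def layer_next)
    then obtain j where j: "j < K" and growth: "f (Suc j) \<le> (m / f 0) powr (1 / real K) * f j"
      using exists_small_growth_step[of f K m] f_pos K_pos by blast
    have m_pos: "0 < m" using f_pos[of K] \<open>f K \<le> m\<close> by linarith
    define I where "I = layer i (2 * j) x \<inter> A"
    define M where "M = layer i (Suc (2 * j)) x \<inter> A"
    define C where "C = layer i (Suc (Suc (2 * j))) x \<inter> A"
    have sub: "I \<subseteq> M" "M \<subseteq> C" "C \<subseteq> A"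
      unfolding I_def M_def C_def
      using layer_mono[of "2 * j" "Suc (2 * j)" i x] layer_mono[of "Suc (2 * j)" "Suc (Suc (2 * j))" i x]
      by auto
    have "x \<in> I" using x AV layer_center by (auto simp: I_def)
    have "C \<subseteq> layer (Suc i) 0 x"
      using layer_mono[of "Suc (Suc (2 * j))" "2 * K" i x] j by (auto simp: C_def layer_next)
    then have "hop_dist G (4 * T * K * h) u v \<le> lab i" if "u \<in> C" "v \<in> C" for u v
      using layer_diam[of u i x v] that i by (auto simp: lab_def)
    then have "small i C"
      unfolding small_def using sub AV by auto
    moreover have "sum \<mu> (layer i 0 y \<inter> C) \<le> f 0" if "y \<in> C" for y
    proof -
      have "sum \<mu> (layer i 0 y \<inter> C) \<le> ?g y" using sub fin AV by (intro sum_\<mu>_mono) auto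
      also have "\<dots> \<le> f 0" using x_max[of y] that sub by (auto simp: f_def)
      finally show ?thesis .
    qed
    ultimately obtain F1 where F1: "clan_on C (lab i) F1" "lifts C \<top> a F1"
      and mass1: "mass C F1 \<le> f 0 powr (1 / real K) * sum \<mu> C"
      using IH by blast
    have "card (A - I) < card A" using fin \<open>x \<in> I\<close> x by (intro psubset_card_mono) auto
    moreover have "small (Suc i) (A - I)" using A by (auto simp: small_def)
    moreover have "sum \<mu> (layer (Suc i) 0 y \<inter> (A - I)) \<le> m" if "y \<in> A - I" for y
      using sum_\<mu>_mono[of "layer (Suc i) 0 y \<inter> (A - I)" "layer (Suc i) 0 y \<inter> A"]
        less.prems(2)[of y] that fin AV by force
    ultimately obtain F2 where F2: "clan_on (A - I) (lab (Suc i)) F2"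
      "lifts (A - I) (ennreal (2 ^ i * r)) a F2"
      and mass2: "mass (A - I) F2 \<le> m powr (1 / real K) * sum \<mu> (A - I)"
      using less.hyps by blast
    have "\<exists>F. clan_on A (lab (Suc i)) F \<and> lifts A (ennreal (2 ^ i * r)) a F \<and>
        (\<forall>v\<in>A. card (copies F v) =
          (if v \<in> C then card (copies F1 v) else 0) + (if v \<in> I then 0 else card (copies F2 v)))"
    proof (rule glue[OF F1(1) lab_mono F2(1) sub F1(2) F2(2)])
      show "v \<in> C" if "u \<in> M" "v \<in> A" "hop_dist G h u v \<le> ennreal (2 ^ i * r)" for u v
        using layer_step[of u i "Suc (2 * j)" x v] that by (auto simp: M_def C_def)
      show "u \<in> M" if "u \<in> A" "v \<in> I" "hop_dist G h u v \<le> ennreal (2 ^ i * r)" for u v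
        using layer_step[of v i "2 * j" x u] that by (auto simp: M_def I_def hop_dist_sym)
    qed (use A far_enough_lab[OF i] lab_pos in \<open>auto simp: small_def\<close>)
    then obtain F where F: "clan_on A (lab (Suc i)) F" "lifts A (ennreal (2 ^ i * r)) a F"
      and card_F: "\<And>v. v \<in> A \<Longrightarrow> card (copies F v) =
          (if v \<in> C then card (copies F1 v) else 0) + (if v \<in> I then 0 else card (copies F2 v))"
      by blast
    have "mass A F = (\<Sum>v\<in>A. if v \<in> C then \<mu> v * card (copies F1 v) else 0)
        + (\<Sum>v\<in>A. if v \<in> A - I then \<mu> v * card (copies F2 v) else 0)"
      unfolding mass_def sum.distrib[symmetric] by (intro sum.cong) (auto simp: card_F algebra_simps)
    also have "\<dots> = mass C F1 + mass (A - I) F2"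
      unfolding mass_def using fin sub
      by (intro arg_cong2[where f = "(+)"] sum.mono_neutral_cong_right) auto
    also have "mass C F1 \<le> m powr (1 / real K) * sum \<mu> I"
    proof -
      have "mass C F1 \<le> f 0 powr (1 / real K) * f (Suc j)"
        using mass1 by (simp add: C_def f_def)
      also have "\<dots> \<le> f 0 powr (1 / real K) * ((m / f 0) powr (1 / real K) * f j)"
        using growth by (rule mult_left_mono) simp
      also have "\<dots> = m powr (1 / real K) * sum \<mu> I"
        using f_pos[of 0] m_pos by (simp add: powr_divide I_def f_def)
      finally show ?thesis .
    qed
    finally have "mass A F \<le> m powr (1 / real K) * sum \<mu> I + m powr (1 / real K) * sum \<mu> (A - I)"
      using mass2 by simp
    also have "\<dots> = m powr (1 / real K) * sum \<mu> A"
      using sub fin sum.subset_diff[of I A \<mu>] by (simp add: algebra_simps)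
    finally show ?thesis using F by blast
  qed
qed

text \<open>Every scale from 0 to \<open>i\<close> applies \<open>lifts_long\<close> once, adding
  \<open>16 * K\<close> to the path factor, while the mass bound passes upward without loss.\<close>

lemma exists_embedding:
  assumes "i \<le> T" and "small i A"
    and "\<And>y. y \<in> A \<Longrightarrow> sum \<mu> (layer i 0 y \<inter> A) \<le> m"
  shows "\<exists>F. clan_on A (lab i) F \<and> lifts A \<top> (real (Suc i) * (16 * real K)) F \<and>
      mass A F \<le> m powr (1 / real K) * sum \<mu> A"
  using assms
proof (induction i arbitrary: A m)
  case 0
  obtain F where F: "clan_on A (lab 0) F" "lifts A 0 0 F" "mass A F = sum \<mu> A"
    using exists_embedding_singletons[OF 0(2)] by blast
  \<comment> \<open>A ball contains its center, hence \<open>1 \<le> m\<close>. Here weights of at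
    least 1 are used, not just positive ones.\<close>
  have "sum \<mu> A \<le> m powr (1 / real K) * sum \<mu> A"
  proof (cases "A = {}")
    case False
    then obtain x where x: "x \<in> A" by blast
    have AV: "A \<subseteq> verts G" "finite A" using 0(2) finite_small by (auto simp: small_def)
    then have "1 \<le> sum \<mu> (layer 0 0 x \<inter> A)"
      using x layer_center[of x] by (intro sum_\<mu>_pos[of x]) auto
    also have "\<dots> \<le> m" using 0(3) x .
    finally have "1 \<le> m powr (1 / real K)" by (intro ge_one_powr_ge_zero) auto
    then show ?thesis using sum_\<mu>_pos[OF x AV(2,1)] by simp
  qed simp
  then show ?case
    using F lifts_long[OF F(1,2) _ far_enough_lab_0] by auto
next
  case (Suc i)
  obtain F where F: "clan_on A (lab (Suc i)) F"
    "lifts A (ennreal (2 ^ i * r)) (real (Suc i) * (16 * real K)) F"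
    "mass A F \<le> m powr (1 / real K) * sum \<mu> A"
    using exists_embedding_step[of i "real (Suc i) * (16 * real K)" A m] Suc by auto
  have "lifts A \<top> (real (Suc i) * (16 * real K) + 16 * real K) F"
    using lifts_long[OF F(1,2)] far_enough_lab[of i] Suc.prems by simp
  then show ?case using F by (auto simp: algebra_simps)
qed

text \<open>All larger parameters are quantified in because later \<open>T\<close> is known only
  through an upper bound.\<close>

theorem exists_clan_embedding:
  "\<exists>F :: ('a, nat) embedding. ultrametric_clan_embedding G F \<and>
      (\<forall>v\<in>verts G. finite (copies F v)) \<and>
      (\<forall>t' \<beta>. 16 * real K \<le> t' \<longrightarrow> 4 * real T * real K \<le> \<beta> \<longrightarrow> hop_distortion G F t' \<beta> h) \<and>
      (\<forall>s. real (Suc T) * (16 * real K) \<le> s \<longrightarrow> hop_path_distortion G F s h) \<and>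
      (\<Sum>v\<in>verts G. \<mu> v * real (card (copies F v))) \<le>
        sum \<mu> (verts G) powr (1 / real K) * sum \<mu> (verts G)"
proof -
  have "small T (verts G)" by (simp add: small_def lab_def)
  moreover have "sum \<mu> (layer T 0 y \<inter> verts G) \<le> sum \<mu> (verts G)" for y
    using weighted_graph by (intro sum_\<mu>_mono) (auto simp: weighted_graph_def)
  ultimately obtain F where F: "clan_on (verts G) (lab T) F"
    and lift: "lifts (verts G) \<top> (real (Suc T) * (16 * real K)) F"
    and mass: "mass (verts G) F \<le> sum \<mu> (verts G) powr (1 / real K) * sum \<mu> (verts G)"
    using exists_embedding[of T "verts G" "sum \<mu> (verts G)"] by blast
  let ?H = "4 * T * K * h"
  have cop: "finite (copies F v)" "copies F v \<subseteq> points F" "chief F v \<in> copies F v" if "v \<in> verts G" for v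
    using F that by (auto simp: clan_on_def)
  have dom: "hop_dist G ?H u v \<le> copies_dist F u v" if "u \<in> verts G" "v \<in> verts G" for u v
    using F that unfolding copies_dist_def clan_on_def by (intro INF_greatest) blast
  have "graph_dist G u v \<le> copies_dist F u v" if "u \<in> verts G" "v \<in> verts G" for u v
    using graph_dist_le_hop_dist dom[OF that] by (rule order.trans)
  then have "dominating G F" by (simp add: dominating_def)
  moreover have "one_to_many G F"
    using F cop unfolding one_to_many_def clan_on_def by blast
  ultimately have "ultrametric_clan_embedding G F"
    using F cop by (simp add: ultrametric_clan_embedding_def clan_on_def)
  moreover have "hop_distortion G F t' \<beta> h" if t': "16 * real K \<le> t'" and \<beta>: "4 * real T * real K \<le> \<beta>" for t' \<beta>
    unfolding hop_distortion_def
  proof (intro ballI conjI)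
    fix u v assume uv: "u \<in> verts G" "v \<in> verts G"
    have "real ?H \<le> \<beta> * real h" using mult_right_mono[OF \<beta>, of "real h"] by simp
    then have "?H \<le> nat \<lfloor>\<beta> * real h\<rfloor>" by (simp add: le_nat_floor)
    then have "hop_dist G (nat \<lfloor>\<beta> * real h\<rfloor>) u v \<le> hop_dist G ?H v u"
      by (subst hop_dist_sym[of G ?H]) (rule hop_dist_antimono)
    then show "hop_dist G (nat \<lfloor>\<beta> * real h\<rfloor>) u v \<le> copies_dist F v u"
      using dom[OF uv(2,1)] by (rule order.trans)
    obtain y where y: "y \<in> copies F v" "pdist F y (chief F u) \<le> ennreal (16 * real K) * hop_dist G h u v"
      using F uv unfolding clan_on_def by blast
    then have "(INF v'\<in>copies F v. pdist F v' (chief F u)) \<le> ennreal (16 * real K) * hop_dist G h u v"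
      by (meson INF_lower2)
    also have "\<dots> \<le> ennreal t' * hop_dist G h u v"
      using t' by (intro mult_right_mono ennreal_leI) auto
    finally show "(INF v'\<in>copies F v. pdist F v' (chief F u)) \<le> ennreal t' * hop_dist G h u v" .
  qed
  moreover have "hop_path_distortion G F s h" if s: "real (Suc T) * (16 * real K) \<le> s" for s
    unfolding hop_path_distortion_def
  proof (intro allI impI)
    fix p assume p: "h_respecting_path G h p"
    then have path: "is_path G p" by (simp add: h_respecting_path_def)
    then obtain q where q: "list_all2 (\<lambda>y v. y \<in> copies F v) q p"
      and cost: "chain_sum (pdist F) q \<le> ennreal (real (Suc T) * (16 * real K) * path_weight G p)"
      using lift h_respecting_path_imp_segment_respecting[OF p]
      unfolding lifts_def is_path_def by (meson top_greatest)
    have "(\<Sum>i<length p - 1. pdist F (q ! i) (q ! Suc i)) = chain_sum (pdist F) q"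
      using list_all2_lengthD[OF q] by (simp add: chain_sum_def)
    also note cost
    also have "ennreal (real (Suc T) * (16 * real K) * path_weight G p) \<le> ennreal (s * path_weight G p)"
      using s path_weight_nonneg[OF weighted_graph path] by (intro ennreal_leI mult_right_mono)
    finally show "\<exists>q. length q = length p \<and> (\<forall>i<length p. q ! i \<in> copies F (p ! i)) \<and>
        (\<Sum>i<length p - 1. pdist F (q ! i) (q ! Suc i)) \<le> ennreal (s * path_weight G p)"
      using q by (intro exI[of _ q]) (simp add: list_all2_conv_all_nth)
  qed
  ultimately show ?thesis using cop mass unfolding mass_def by blast
qed

end


section \<open>Sampling\<close>

lemma log_factor_ge: "1 \<le> log_factor n" "ln (real n) \<le> log_factor n"
  by (auto simp: log_factor_def)

text \<open>The scales span a factor \<open>n powr (1 + max c 0)\<close>: one \<open>n\<close> for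
  the hops, the rest for the aspect ratio. Rounding up and the extra scale add 2, which with
  \<open>1 / ln 2 \<le> 2\<close> gives the constant \<open>4 + 2 * max c 0\<close>.\<close>

lemma exists_scales:
  fixes G :: "'a wgraph"
  assumes G: "weighted_graph G" and asp: "aspect_ratio_le_pow c G"
    and n: "n = card (verts G)" "1 \<le> n" "h \<le> n"
  shows "\<exists>T r. 0 < T \<and> 0 < r \<and> (\<forall>u v. u \<noteq> v \<longrightarrow> ennreal r \<le> hop_dist G h u v) \<and>
    (\<forall>u v. hop_dist G h u v < \<infinity> \<longrightarrow> hop_dist G h u v \<le> ennreal (2 ^ (T - 1) * r)) \<and>
    real T \<le> (4 + 2 * max c 0) * log_factor n"
proof (cases "edges G = {}")
  case True
  \<comment> \<open>Without edges every distance is 0 or infinite, and a single scale with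
    \<open>r = 1\<close> suffices.\<close>
  have "1 \<le> (4 + 2 * max c 0) * log_factor n"
    using mult_mono[of 1 "4 + 2 * max c 0" 1 "log_factor n"] log_factor_ge[of n] by simp
  moreover have "hop_dist G h u v \<le> ennreal (2 ^ (1 - 1) * 1)" if "hop_dist G h u v < \<infinity>" for u v
    using hop_dist_le_finite[OF that, of 0] True by simp
  moreover have "ennreal 1 \<le> hop_dist G h u v" if "u \<noteq> v" for u v
    using that True G by (intro hop_dist_ge_edge) auto
  ultimately show ?thesis by (intro exI[of _ 1]) auto
next
  case False
  define W where "W = Max (wt G ` edges G)"
  define r where "r = Min (wt G ` edges G)"
  define c' where "c' = max c 0"
  have "edges G \<subseteq> Pow (verts G)" using G by (auto simp: weighted_graph_def)
  then have fin: "finite (edges G)" using G by (auto simp: weighted_graph_def intro: finite_subset)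
  have "r \<in> wt G ` edges G" unfolding r_def using fin False by (intro Min_in) auto
  then have r_pos: "0 < r" using G by (auto simp: weighted_graph_def)
  have r_le: "r \<le> wt G e" and le_W: "wt G e \<le> W" if "e \<in> edges G" for e
    using fin that by (auto simp: r_def W_def)
  have "0 \<le> W" using r_pos r_le le_W False by force
  have n_pos: "0 < real n" using n by simp
  have "W / r \<le> real n powr c"
    using asp False by (simp add: aspect_ratio_le_pow_def aspect_ratio_def W_def r_def n)
  also have "\<dots> \<le> real n powr c'" using n by (intro powr_mono) (auto simp: c'_def)
  finally have W_le: "W \<le> real n powr c' * r" using r_pos by (simp add: pos_divide_le_eq)
  define m where "m = nat \<lceil>log 2 (real n powr (1 + c'))\<rceil>"
  have "log 2 (real n powr (1 + c')) \<le> real m" unfolding m_def by linarith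
  then have m: "real n powr (1 + c') \<le> 2 ^ m"
    using n_pos by (simp add: log_le_iff powr_realpow[symmetric])
  have "real h * W \<le> real n * (real n powr c' * r)"
    using n W_le \<open>0 \<le> W\<close> by (intro mult_mono) auto
  also have "\<dots> = real n powr (1 + c') * r" using n_pos by (simp add: powr_add)
  also have "\<dots> \<le> 2 ^ m * r" using m r_pos by (intro mult_right_mono) auto
  finally have "real h * W \<le> 2 ^ m * r" .
  then have "hop_dist G h u v \<le> ennreal (2 ^ (Suc m - 1) * r)" if "hop_dist G h u v < \<infinity>" for u v
    using hop_dist_le_finite[OF that le_W \<open>0 \<le> W\<close>] by (auto intro: order.trans ennreal_leI)
  moreover have "ennreal r \<le> hop_dist G h u v" if "u \<noteq> v" for u v
    using that r_le G by (intro hop_dist_ge_edge) auto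
  moreover have "real (Suc m) \<le> (4 + 2 * c') * log_factor n"
  proof -
    have ln2: "1 / 2 \<le> ln (2 :: real)" using ln_ge_iff[of 2 "1/2 :: real"] exp_le_quadratic[of "1/2"]
      by (simp add: power2_eq_square)
    have "0 \<le> ln (real n)" using n by simp
    then have "0 \<le> log 2 (real n powr (1 + c'))" by (simp add: log_def ln_powr c'_def)
    then have "real m \<le> log 2 (real n powr (1 + c')) + 1" unfolding m_def by linarith
    also have "log 2 (real n powr (1 + c')) = (1 + c') * (ln (real n) / ln 2)"
      using n_pos by (simp add: log_def ln_powr)
    also have "ln (real n) / ln 2 \<le> ln (real n) / (1 / 2)"
      using ln2 \<open>0 \<le> ln (real n)\<close> by (intro divide_left_mono) auto
    also have "\<dots> \<le> 2 * log_factor n" using log_factor_ge[of n] by simp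
    finally have "real m \<le> (1 + c') * (2 * log_factor n) + 1"
      by (simp add: mult_left_mono c'_def)
    then show ?thesis using log_factor_ge[of n] by (simp add: algebra_simps)
  qed
  ultimately show ?thesis using r_pos unfolding c'_def
    by (intro exI[of _ "Suc m"] exI[of _ r]) auto
qed

section \<open>From weighted bounds to a distribution\<close>

lemma expected_copies_uniform:
  assumes "0 < N" and fin: "\<And>i. finite (copies (F i) v)"
  shows "expected_copies (map_pmf F (pmf_of_set {..<N})) v =
    ennreal ((\<Sum>i<N. real (card (copies (F i) v))) / real N)"
proof -
  have "expected_copies (map_pmf F (pmf_of_set {..<N})) v =
      (\<integral>\<^sup>+i. emeasure (count_space UNIV) (copies (F i) v) \<partial>pmf_of_set {..<N})"
    by (simp add: expected_copies_def)
  also have "\<dots> = (\<Sum>i<N. emeasure (count_space UNIV) (copies (F i) v)) / real N"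
    using assms(1) by (subst nn_integral_pmf_of_set) (auto simp: ennreal_of_nat_eq_real_of_nat)
  also have "(\<Sum>i<N. emeasure (count_space UNIV) (copies (F i) v)) =
      ennreal (\<Sum>i<N. real (card (copies (F i) v)))"
    using fin by (simp add: ennreal_of_nat_eq_real_of_nat)
  finally show ?thesis using assms(1) by (simp add: divide_ennreal sum_nonneg)
qed

text \<open>The distribution is uniform on the answers given in finitely many rounds of the minimax
  game, so \<open>P\<close> holds on the whole support; \<delta> is the error left by
  stopping.\<close>

lemma exists_distribution:
  fixes P :: "('a, nat) embedding \<Rightarrow> bool"
  assumes V: "finite V" "V \<noteq> {}" and \<delta>: "0 < \<delta>"
    and nonempty: "\<And>F v. P F \<Longrightarrow> v \<in> V \<Longrightarrow> finite (copies F v) \<and> copies F v \<noteq> {}"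
    and weighted: "\<And>\<mu> :: 'a \<Rightarrow> real. (\<And>v. v \<in> V \<Longrightarrow> 1 \<le> \<mu> v) \<Longrightarrow>
      \<exists>F. P F \<and> (\<Sum>v\<in>V. \<mu> v * real (card (copies F v))) \<le> sum \<mu> V powr (1 / real K) * sum \<mu> V"
  shows "\<exists>D. (\<forall>F\<in>set_pmf D. P F) \<and> (\<forall>v\<in>V. expected_copies D v \<le>
    ennreal (2 * (2 * real (card V)) powr (1 / real K) - 1 + \<delta>))"
proof -
  let ?n = "real (card V)"
  define q where "q = (2 * ?n) powr (1 / real K)"
  have n: "1 \<le> ?n" using V by (simp add: Suc_le_eq card_gt_0_iff)
  have q: "1 \<le> q" unfolding q_def using n by (intro ge_one_powr_ge_zero) auto
  define vec :: "('a, nat) embedding \<Rightarrow> 'a \<Rightarrow> real" where "vec F v = real (card (copies F v))" for F v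
  \<comment> \<open>The cutoff supplies the boundedness needed by
    \<open>approximate_minimax\<close>; the answers below meet it because every weight is at least
    1.\<close>
  define S where "S = vec ` {F. P F \<and> (\<forall>v\<in>V. vec F v \<le> q * (2 * ?n))}"
  have vec_ge_1: "1 \<le> vec F v" if "P F" "v \<in> V" for F v
    using nonempty[OF that] by (simp add: vec_def Suc_le_eq card_gt_0_iff)
  have response: "\<exists>a\<in>S. (\<Sum>v\<in>V. p v * a v) \<le> 2 * q - 1"
    if p: "\<And>v. v \<in> V \<Longrightarrow> 0 \<le> p v" "sum p V = 1" for p
  proof -
    \<comment> \<open>The total weight is \<open>2 * ?n\<close> for every \<open>p\<close>, so one
      \<open>q\<close> serves all mixtures.\<close>
    define \<mu> where "\<mu> v = 1 + ?n * p v" for v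
    have \<mu>_ge_1: "1 \<le> \<mu> v" if "v \<in> V" for v using p(1)[OF that] by (simp add: \<mu>_def)
    have "sum \<mu> V = 2 * ?n" using p(2) by (simp add: \<mu>_def sum.distrib sum_distrib_left[symmetric])
    then obtain F where F: "P F" and total: "(\<Sum>v\<in>V. \<mu> v * vec F v) \<le> q * (2 * ?n)"
      using weighted[of \<mu>] \<mu>_ge_1 by (auto simp: q_def vec_def)
    have "vec F v \<le> q * (2 * ?n)" if v: "v \<in> V" for v
    proof -
      have "1 * vec F v \<le> \<mu> v * vec F v" using \<mu>_ge_1[OF v] by (intro mult_right_mono) (auto simp: vec_def)
      also have "\<dots> \<le> (\<Sum>v\<in>V. \<mu> v * vec F v)"
        using V v \<mu>_ge_1 by (intro member_le_sum) (auto simp: vec_def intro!: mult_nonneg_nonneg intro: order.trans[OF zero_le_one])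
      finally show ?thesis using total by simp
    qed
    then have "vec F \<in> S" using F by (auto simp: S_def)
    moreover have "(\<Sum>v\<in>V. p v * vec F v) \<le> 2 * q - 1"
    proof -
      \<comment> \<open>The unit part of \<mu> contributes at least \<open>?n\<close> to the total,
        one per vertex; this becomes the \<open>- 1\<close>.\<close>
      have "?n \<le> (\<Sum>v\<in>V. vec F v)" using sum_mono[of V "\<lambda>_. 1" "vec F"] vec_ge_1[OF F] by simp
      moreover have "(\<Sum>v\<in>V. \<mu> v * vec F v) = (\<Sum>v\<in>V. vec F v) + ?n * (\<Sum>v\<in>V. p v * vec F v)"
        by (simp add: \<mu>_def sum.distrib sum_distrib_left algebra_simps)
      ultimately have "?n * (\<Sum>v\<in>V. p v * vec F v) \<le> ?n * (2 * q - 1)"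
        using total by (simp add: algebra_simps)
      then show ?thesis using n by simp
    qed
    ultimately show ?thesis by blast
  qed
  have "\<exists>N>0. \<exists>a :: nat \<Rightarrow> 'a \<Rightarrow> real.
      (\<forall>i. a i \<in> S) \<and> (\<forall>v\<in>V. (\<Sum>i<N. a i v) \<le> real N * (2 * q - 1 + \<delta>))"
    by (rule approximate_minimax[OF V \<delta> _ _ response]) (use q in \<open>auto simp: S_def vec_def\<close>)
  then obtain N a where N: "0 < N" and a: "\<And>i. a i \<in> S"
    and average: "\<And>v. v \<in> V \<Longrightarrow> (\<Sum>i<N. a i v) \<le> real N * (2 * q - 1 + \<delta>)"
    by blast
  have "\<forall>i. \<exists>F. P F \<and> a i = vec F" using a by (auto simp: S_def)
  then obtain F where F: "\<And>i. P (F i)" "\<And>i. a i = vec (F i)" by metis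
  have "expected_copies (map_pmf F (pmf_of_set {..<N})) v \<le> ennreal (2 * q - 1 + \<delta>)" if v: "v \<in> V" for v
    using average[OF v] N nonempty[OF F(1) v] F(2)
    by (subst expected_copies_uniform) (auto simp: vec_def pos_divide_le_eq mult_ac intro!: ennreal_leI)
  then show ?thesis using F(1) by (intro exI[of _ "map_pmf F (pmf_of_set {..<N})"]) (auto simp: q_def)
qed

text \<open>\<open>K\<close> ranges over all positive integers and may exceed \<open>n\<close>: the
  second claim takes it of order \<open>log n / \<epsilon>\<close>.\<close>

lemma exists_clan_distribution:
  fixes G :: "'a wgraph"
  assumes G: "weighted_graph G" and asp: "aspect_ratio_le_pow c G"
    and n: "n = card (verts G)" "h \<in> {1..n}" and K: "0 < K" and \<delta>: "0 < \<delta>"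
    and B: "B = 4 + 2 * max c 0"
  shows "\<exists>D :: ('a, nat) embedding pmf.
    (\<forall>F\<in>set_pmf D. ultrametric_clan_embedding G F \<and>
      (\<forall>t' \<beta>. 16 * real K \<le> t' \<longrightarrow> 4 * B * log_factor n * real K \<le> \<beta> \<longrightarrow> hop_distortion G F t' \<beta> h) \<and>
      (\<forall>s. 16 * (B + 1) * log_factor n * real K \<le> s \<longrightarrow> hop_path_distortion G F s h)) \<and>
    (\<forall>v\<in>verts G. expected_copies D v \<le> ennreal (2 * (2 * real n) powr (1 / real K) - 1 + \<delta>))"
proof -
  have "1 \<le> n" "h \<le> n" using n(2) by auto
  from exists_scales[OF G asp n(1) this, folded B]
  obtain T r where T: "0 < T" and r: "0 < r" and T_le: "real T \<le> B * log_factor n"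
    and sep: "\<And>u v. u \<noteq> v \<Longrightarrow> ennreal r \<le> hop_dist G h u v"
    and bnd: "\<And>u v. hop_dist G h u v < \<infinity> \<Longrightarrow> hop_dist G h u v \<le> ennreal (2 ^ (T - 1) * r)"
    by metis
  have "4 * real T * real K \<le> 4 * B * log_factor n * real K"
    using mult_right_mono[OF T_le, of "4 * real K"] by (simp add: mult_ac)
  moreover have "real (Suc T) * (16 * real K) \<le> 16 * (B + 1) * log_factor n * real K"
  proof -
    have "real (Suc T) \<le> (B + 1) * log_factor n"
      using T_le log_factor_ge(1)[of n] by (simp add: algebra_simps)
    then have "real (Suc T) * (16 * real K) \<le> ((B + 1) * log_factor n) * (16 * real K)"
      by (rule mult_right_mono) simp
    then show ?thesis by (simp add: mult_ac)
  qed
  \<comment> \<open>\<open>P\<close> and the scales are fixed before \<mu>, so all answers share the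
    same distortion parameters.\<close>
  moreover define P where "P F \<longleftrightarrow> ultrametric_clan_embedding G F \<and> (\<forall>v\<in>verts G. finite (copies F v)) \<and>
      (\<forall>t' \<beta>. 16 * real K \<le> t' \<longrightarrow> 4 * real T * real K \<le> \<beta> \<longrightarrow> hop_distortion G F t' \<beta> h) \<and>
      (\<forall>s. real (Suc T) * (16 * real K) \<le> s \<longrightarrow> hop_path_distortion G F s h)"
    for F :: "('a, nat) embedding"
  moreover have "\<exists>D. (\<forall>F\<in>set_pmf D. P F) \<and> (\<forall>v\<in>verts G. expected_copies D v \<le>
    ennreal (2 * (2 * real (card (verts G))) powr (1 / real K) - 1 + \<delta>))"
  proof (rule exists_distribution[OF _ _ \<delta>])
    show "finite (verts G)" using G by (simp add: weighted_graph_def)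
    show "verts G \<noteq> {}" using n by auto
    show "finite (copies F v) \<and> copies F v \<noteq> {}" if "P F" "v \<in> verts G" for F v
      using that by (auto simp: P_def ultrametric_clan_embedding_def)
    fix \<mu> :: "'a \<Rightarrow> real" assume \<mu>: "\<And>v. v \<in> verts G \<Longrightarrow> 1 \<le> \<mu> v"
    interpret hop_hierarchy G h K T r \<mu>
      by unfold_locales (use G K T r sep bnd \<mu> in auto)
    show "\<exists>F. P F \<and> (\<Sum>v\<in>verts G. \<mu> v * real (card (copies F v)))
        \<le> sum \<mu> (verts G) powr (1 / real K) * sum \<mu> (verts G)"
      using exists_clan_embedding by (auto simp: P_def)
  qed
  ultimately show ?thesis unfolding P_def n(1) by (meson order.trans)
qed

section \<open>The choice of \<open>K\<close> and of the constants\<close>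

theorem theorem3:
  fixes c :: real
  shows "\<exists>C>0. \<forall>G :: 'a wgraph. \<forall>n h.
    weighted_graph G \<longrightarrow> n = card (verts G) \<longrightarrow> aspect_ratio_le_pow c G \<longrightarrow> h \<in> {1..n} \<longrightarrow>
      (\<forall>k\<in>{1..n}. \<exists>D :: ('a, nat) embedding pmf.
         (\<forall>F\<in>set_pmf D.
            ultrametric_clan_embedding G F \<and>
            hop_distortion G F (C * real k) (C * real k * log_factor n) h \<and>
            hop_path_distortion G F (C * real k * log_factor n) h) \<and>
         (\<forall>v\<in>verts G. expected_copies D v \<le> ennreal (C * real n powr (1 / real k)))) \<and>
      (\<forall>\<epsilon>::real. 0 < \<epsilon> \<and> \<epsilon> < 1 \<longrightarrow> (\<exists>D :: ('a, nat) embedding pmf.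
         (\<forall>F\<in>set_pmf D.
            ultrametric_clan_embedding G F \<and>
            hop_distortion G F (C * log_factor n / \<epsilon>) (C * (log_factor n)\<^sup>2 / \<epsilon>) h \<and>
            hop_path_distortion G F (C * (log_factor n)\<^sup>2 / \<epsilon>) h) \<and>
         (\<forall>v\<in>verts G. expected_copies D v \<le> ennreal (1 + \<epsilon>))))"
proof -
  define B where "B = 4 + 2 * max c 0"
  have B: "4 \<le> B" by (simp add: B_def)
  \<comment> \<open>272 is 17 * 16, where 16 comes from the stretch \<open>16 * K\<close> and 17
    from the bound \<open>K \<le> 17 * log_factor n / \<epsilon>\<close> in the second
    claim.\<close>
  define C where "C = 272 * (B + 1)"
  have C: "16 \<le> C" "4 * B \<le> C" "16 * (B + 1) \<le> C" "17 * 16 \<le> C" "17 * (4 * B) \<le> C" "17 * (16 * (B + 1)) \<le> C"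
    using B by (auto simp: C_def)
  show ?thesis
  proof (intro exI[of _ C] conjI allI impI ballI)
    show "0 < C" using C by simp
    fix G :: "'a wgraph" and n h
    assume G: "weighted_graph G" "aspect_ratio_le_pow c G" "n = card (verts G)" "h \<in> {1..n}"
    note distribution = exists_clan_distribution[OF G(1,2,3,4) _ _ B_def]
    let ?l = "log_factor n"
    have l: "1 \<le> ?l" and n: "1 \<le> n" using log_factor_ge[of n] G by auto
    {
      fix k assume k: "k \<in> {1..n}"
      \<comment> \<open>Here \<delta> is 1, which cancels the \<open>- 1\<close>.\<close>
      have "2 * (2 * real n) powr (1 / real k) - 1 + 1 = 2 * 2 powr (1 / real k) * real n powr (1 / real k)"
        by (simp add: powr_mult)
      also have "\<dots> \<le> C * real n powr (1 / real k)"
      proof (intro mult_right_mono)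
        have "(2::real) powr (1 / real k) \<le> 2 powr 1" using k by (intro powr_mono) auto
        then show "2 * 2 powr (1 / real k) \<le> C" using C by simp
      qed simp
      finally have "expected_copies D v \<le> ennreal (C * real n powr (1 / real k))"
        if "expected_copies D v \<le> ennreal (2 * (2 * real n) powr (1 / real k) - 1 + 1)"
        for D :: "('a, nat) embedding pmf" and v
        using that by (meson ennreal_leI order.trans)
      moreover have "16 * real k \<le> C * real k" using C by (intro mult_right_mono) auto
      moreover have "4 * B * ?l * real k \<le> C * real k * ?l"
        using mult_right_mono[OF C(2), of "?l * real k"] l by (simp add: mult_ac)
      moreover have "16 * (B + 1) * ?l * real k \<le> C * real k * ?l"
        using mult_right_mono[OF C(3), of "?l * real k"] l by (simp add: mult_ac)
      ultimately show "\<exists>D :: ('a, nat) embedding pmf.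
         (\<forall>F\<in>set_pmf D.
            ultrametric_clan_embedding G F \<and>
            hop_distortion G F (C * real k) (C * real k * log_factor n) h \<and>
            hop_path_distortion G F (C * real k * log_factor n) h) \<and>
         (\<forall>v\<in>verts G. expected_copies D v \<le> ennreal (C * real n powr (1 / real k)))"
        using distribution[of k 1] k by (metis (no_types, lifting) atLeastAtMost_iff less_eq_Suc_le One_nat_def zero_less_one)
    next
      fix \<epsilon> :: real assume "0 < \<epsilon> \<and> \<epsilon> < 1"
      then have \<epsilon>: "0 < \<epsilon>" "\<epsilon> < 1" by auto
      define L where "L = ln (2 * real n)"
      have L_eq: "L = ln 2 + ln (real n)" using n by (simp add: L_def ln_mult)
      have "0 < L" using n by (simp add: L_def)
      have "ln (2::real) \<le> 1" using ln_le_minus_one[of 2] by simp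
      then have L_le: "L \<le> 2 * ?l" using L_eq l log_factor_ge(2)[of n] by simp
      \<comment> \<open>Then \<open>(2 * n) powr (1 / K) \<le> exp (\<epsilon> / 8) \<le> 1 +
        \<epsilon> / 4\<close>; twice this minus 1 is \<open>1 + \<epsilon> / 2\<close>, leaving
        \<open>\<epsilon> / 2\<close> for \<delta>.\<close>
      define K where "K = nat \<lceil>8 * L / \<epsilon>\<rceil>"
      have "0 < 8 * L / \<epsilon>" using \<open>0 < L\<close> \<epsilon> by simp
      then have K: "0 < K" "8 * L / \<epsilon> \<le> real K" "real K \<le> 8 * L / \<epsilon> + 1"
        unfolding K_def by linarith+
      \<comment> \<open>This gives 17 as 16 + 1: \<open>L\<close> is at most twice
        \<open>?l\<close>, and rounding up costs at most \<open>?l / \<epsilon>\<close>.\<close>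
      have "8 * L / \<epsilon> + 1 \<le> 8 * (2 * ?l) / \<epsilon> + ?l / \<epsilon>"
      proof (rule add_mono)
        show "8 * L / \<epsilon> \<le> 8 * (2 * ?l) / \<epsilon>" using L_le \<epsilon> by (intro divide_right_mono) auto
        show "1 \<le> ?l / \<epsilon>" using l \<epsilon> by (simp add: pos_le_divide_eq)
      qed
      with K(3) have K_le: "real K \<le> 17 * (?l / \<epsilon>)" by simp
      have "L / real K \<le> \<epsilon> / 8" using K \<epsilon> by (simp add: field_simps)
      then have "(2 * real n) powr (1 / real K) \<le> exp (\<epsilon> / 8)"
        using n by (simp add: powr_def L_def)
      also have "\<dots> \<le> 1 + \<epsilon> / 8 + (\<epsilon> / 8)\<^sup>2" using \<epsilon> by (intro exp_le_quadratic) auto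
      also have "(\<epsilon> / 8)\<^sup>2 \<le> \<epsilon> / 8 * 1" unfolding power2_eq_square using \<epsilon> by (intro mult_left_mono) auto
      finally have "2 * (2 * real n) powr (1 / real K) - 1 + \<epsilon> / 2 \<le> 1 + \<epsilon>" by simp
      then have "expected_copies D v \<le> ennreal (1 + \<epsilon>)"
        if "expected_copies D v \<le> ennreal (2 * (2 * real n) powr (1 / real K) - 1 + \<epsilon> / 2)"
        for D :: "('a, nat) embedding pmf" and v
        using that by (meson ennreal_leI order.trans)
      moreover have scale: "x * real K \<le> C * (?l / \<epsilon>)" if "0 \<le> x" "17 * x \<le> C" for x
      proof -
        have "x * real K \<le> x * (17 * (?l / \<epsilon>))" using K_le that(1) by (rule mult_left_mono)
        also have "\<dots> = (17 * x) * (?l / \<epsilon>)" by simp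
        also have "\<dots> \<le> C * (?l / \<epsilon>)" using that(2) l \<epsilon> by (intro mult_right_mono) auto
        finally show ?thesis .
      qed
      have "16 * real K \<le> C * ?l / \<epsilon>" using scale[of 16] C by simp
      moreover have "4 * B * ?l * real K \<le> C * ?l\<^sup>2 / \<epsilon>"
        using mult_left_mono[OF scale[of "4 * B"], of ?l] C B l by (simp add: power2_eq_square mult_ac)
      moreover have "16 * (B + 1) * ?l * real K \<le> C * ?l\<^sup>2 / \<epsilon>"
        using mult_left_mono[OF scale[of "16 * (B + 1)"], of ?l] C B l by (simp add: power2_eq_square mult_ac)
      ultimately show "\<exists>D :: ('a, nat) embedding pmf.
         (\<forall>F\<in>set_pmf D.
            ultrametric_clan_embedding G F \<and>
            hop_distortion G F (C * log_factor n / \<epsilon>) (C * (log_factor n)\<^sup>2 / \<epsilon>) h \<and>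
            hop_path_distortion G F (C * (log_factor n)\<^sup>2 / \<epsilon>) h) \<and>
         (\<forall>v\<in>verts G. expected_copies D v \<le> ennreal (1 + \<epsilon>))"
        using distribution[of K "\<epsilon> / 2"] K(1) \<epsilon>(1) by (metis (no_types, lifting) half_gt_zero)
    }
  qed
qed

end
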